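(* For every $f \in L^{\infty}([0,\infty))$, $$\sup_{\varphi \in \mathcal{D}} \varphi(f) = \overline{K}(f).$$
   Context: $L^{\infty}([0,\infty))$ is the space of real-valued essentially bounded measurable functions on $[0,\infty)$ (Lebesgue measure), and $L^{\infty}([0,\infty))^*$ is its dual. For $f\in L^{\infty}([0,\infty))$ put $R(f)=\lim_{x\to\infty}\frac{1}{e^x}\int_0^x f(t)e^t\,dt$ whenever this limit exists. $F_0$ is the subspace of all $f\in L^\infty([0,\infty))$ for which $R(f)$ exists and equals $0$. $\mathcal{D}$ is the set of positive linear functionals of norm $1$ on $L^{\infty}([0,\infty))$ that vanish on $F_0$. The sublinear functional $\overline{K}$ is $$\overline{K}(f)=\lim_{\theta\to0^+}\limsup_{x\to\infty}\frac{1}{\theta}\int_x^{x+\theta}f(t)\,dt .$$ *)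

theory Defs
  imports "HOL-Analysis.Analysis" "HOL-Probability.Essential_Supremum"
begin

section \<open>The normed space of essentially bounded functions on the half line\<close>

abbreviation halfline :: "real measure" where
  "halfline \<equiv> lebesgue_on {0..}"

definition ess_bounded :: "(real \<Rightarrow> real) \<Rightarrow> bool" where
  "ess_bounded f \<longleftrightarrow>
     f \<in> borel_measurable halfline \<and> (\<exists>C. AE x in halfline. \<bar>f x\<bar> \<le> C)"

definition linf_rel :: "(real \<Rightarrow> real) \<Rightarrow> (real \<Rightarrow> real) \<Rightarrow> bool" where
  "linf_rel f g \<longleftrightarrow> ess_bounded f \<and> ess_bounded g \<and> (AE x in halfline. f x = g x)"

lemma ess_bounded_const: "ess_bounded (\<lambda>_. c)"
  by (auto simp: ess_bounded_def)

lemma ess_bounded_add: "ess_bounded f \<Longrightarrow> ess_bounded g \<Longrightarrow> ess_bounded (\<lambda>x. f x + g x)"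
proof -
  assume f: "ess_bounded f" and g: "ess_bounded g"
  then obtain C D where "AE x in halfline. \<bar>f x\<bar> \<le> C" "AE x in halfline. \<bar>g x\<bar> \<le> D"
    by (auto simp: ess_bounded_def)
  then have "AE x in halfline. \<bar>f x + g x\<bar> \<le> C + D"
    by eventually_elim linarith
  with f g show ?thesis unfolding ess_bounded_def by (blast intro: borel_measurable_add)
qed

lemma ess_bounded_scale: "ess_bounded f \<Longrightarrow> ess_bounded (\<lambda>x. c * f x)"
proof -
  assume f: "ess_bounded f"
  then obtain C where "AE x in halfline. \<bar>f x\<bar> \<le> C"
    by (auto simp: ess_bounded_def)
  then have "AE x in halfline. \<bar>c * f x\<bar> \<le> \<bar>c\<bar> * C"
    by eventually_elim (simp add: abs_mult mult_left_mono)
  with f show ?thesis unfolding ess_bounded_def by auto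
qed

lemma ess_bounded_minus: "ess_bounded f \<Longrightarrow> ess_bounded (\<lambda>x. - f x)"
  using ess_bounded_scale[of f "-1"] by simp

lemma ess_bounded_diff: "ess_bounded f \<Longrightarrow> ess_bounded g \<Longrightarrow> ess_bounded (\<lambda>x. f x - g x)"
  using ess_bounded_add[of f "\<lambda>x. - g x"] ess_bounded_minus[of g] by simp

lemma part_equivp_linf_rel: "part_equivp linf_rel"
proof (rule part_equivpI)
  show "\<exists>f. linf_rel f f"
    by (rule exI[of _ "\<lambda>_. 0"]) (simp add: linf_rel_def ess_bounded_const)
  show "symp linf_rel"
    by (rule sympI) (auto simp: linf_rel_def)
  show "transp linf_rel"
    by (rule transpI) (auto simp: linf_rel_def elim: AE_mp)
qed

text \<open>The relation \<open>linf_rel\<close> is reflexive exactly on the essentially bounded functions, so this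
  is the space of their classes modulo equality almost everywhere on \<open>[0,\<infinity>)\<close>; the values of a
  representative at negative arguments are irrelevant.\<close>

quotient_type linf = "real \<Rightarrow> real" / partial: linf_rel
  by (rule part_equivp_linf_rel)

lemma emeasure_halfline_nonzero: "emeasure halfline (space halfline) \<noteq> 0"
proof
  assume "emeasure halfline (space halfline) = 0"
  then have "emeasure lebesgue {0::real..} = 0"
    by (simp add: emeasure_restrict_space)
  moreover have "emeasure lebesgue {0..1::real} \<le> emeasure lebesgue {0::real..}"
    by (rule emeasure_mono) auto
  ultimately show False by simp
qed

abbreviation ess_norm :: "(real \<Rightarrow> real) \<Rightarrow> ereal" where
  "ess_norm f \<equiv> esssup halfline (\<lambda>x. ereal \<bar>f x\<bar>)"

lemma ess_norm_nonneg: "0 \<le> ess_norm f"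
proof (cases "(\<lambda>x. ereal \<bar>f x\<bar>) \<in> borel_measurable halfline")
  case True
  have "esssup halfline (\<lambda>_. 0::ereal) \<le> ess_norm f"
    by (rule esssup_AE_mono) auto
  then show ?thesis
    using esssup_const[OF emeasure_halfline_nonzero, of "0::ereal"] by simp
qed (simp add: esssup_non_measurable)

lemma ess_norm_finite: "ess_bounded f \<Longrightarrow> \<exists>r\<ge>0. ess_norm f = ereal r"
proof -
  assume f: "ess_bounded f"
  then obtain C where "AE x in halfline. \<bar>f x\<bar> \<le> C"
    by (auto simp: ess_bounded_def)
  then have "ess_norm f \<le> ereal C"
    using f by (intro esssup_I) (auto simp: ess_bounded_def)
  with ess_norm_nonneg[of f] show ?thesis
    by (cases "ess_norm f") auto
qed

instantiation linf :: real_normed_vector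
begin

lift_definition zero_linf :: linf is "\<lambda>_. 0"
  by (simp add: linf_rel_def ess_bounded_const)

lift_definition plus_linf :: "linf \<Rightarrow> linf \<Rightarrow> linf" is "\<lambda>f g x. f x + g x"
  by (auto simp: linf_rel_def ess_bounded_add)

lift_definition minus_linf :: "linf \<Rightarrow> linf \<Rightarrow> linf" is "\<lambda>f g x. f x - g x"
  by (auto simp: linf_rel_def ess_bounded_diff)

lift_definition uminus_linf :: "linf \<Rightarrow> linf" is "\<lambda>f x. - f x"
  by (auto simp: linf_rel_def ess_bounded_minus)

lift_definition scaleR_linf :: "real \<Rightarrow> linf \<Rightarrow> linf" is "\<lambda>c f x. c * f x"
  by (auto simp: linf_rel_def ess_bounded_scale)

lift_definition norm_linf :: "linf \<Rightarrow> real" is "\<lambda>f. real_of_ereal (ess_norm f)"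
proof -
  fix f g assume "linf_rel f g"
  then have "ess_norm f = ess_norm g"
    by (intro esssup_AE_cong) (auto simp: linf_rel_def ess_bounded_def)
  then show "real_of_ereal (ess_norm f) = real_of_ereal (ess_norm g)" by simp
qed

definition dist_linf :: "linf \<Rightarrow> linf \<Rightarrow> real" where
  "dist_linf f g = norm (f - g)"

definition sgn_linf :: "linf \<Rightarrow> linf" where
  "sgn_linf f = inverse (norm f) *\<^sub>R f"

definition uniformity_linf :: "(linf \<times> linf) filter" where
  "uniformity_linf = (INF e\<in>{0<..}. principal {(x, y). dist x y < e})"

definition open_linf :: "linf set \<Rightarrow> bool" where
  "open_linf U \<longleftrightarrow> (\<forall>x\<in>U. eventually (\<lambda>(x', y). x' = x \<longrightarrow> y \<in> U) uniformity)"

instance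
proof
  fix f g h :: linf and a b :: real and U :: "linf set"
  show "f + g + h = f + (g + h)"
    by transfer (auto simp: linf_rel_def ess_bounded_add add.assoc)
  show "f + g = g + f"
    by transfer (auto simp: linf_rel_def ess_bounded_add add.commute)
  show "0 + f = f"
    by transfer (auto simp: linf_rel_def)
  show "- f + f = 0"
    by transfer (auto simp: linf_rel_def ess_bounded_const)
  show "f - g = f + - g"
    by transfer (auto simp: linf_rel_def ess_bounded_diff)
  show "a *\<^sub>R (f + g) = a *\<^sub>R f + a *\<^sub>R g"
    by transfer (auto simp: linf_rel_def ess_bounded_scale ess_bounded_add ring_distribs)
  show "(a + b) *\<^sub>R f = a *\<^sub>R f + b *\<^sub>R f"
    by transfer (auto simp: linf_rel_def ess_bounded_scale ess_bounded_add ring_distribs)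
  show "a *\<^sub>R b *\<^sub>R f = (a * b) *\<^sub>R f"
    by transfer (auto simp: linf_rel_def ess_bounded_scale mult.assoc)
  show "1 *\<^sub>R f = f"
    by transfer (auto simp: linf_rel_def)
  show "dist f g = norm (f - g)" by (simp add: dist_linf_def)
  show "sgn f = inverse (norm f) *\<^sub>R f" by (simp add: sgn_linf_def)
  show "uniformity = (INF e\<in>{0<..}. principal {(x::linf, y). dist x y < e})"
    by (simp add: uniformity_linf_def)
  show "open U \<longleftrightarrow> (\<forall>x\<in>U. \<forall>\<^sub>F (x', y) in uniformity. x' = x \<longrightarrow> y \<in> U)"
    by (simp add: open_linf_def)
  show "norm f = 0 \<longleftrightarrow> f = 0"
  proof transfer
    fix f assume "linf_rel f f"
    then have f: "ess_bounded f" by (simp add: linf_rel_def)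
    then have meas: "f \<in> borel_measurable halfline" by (simp add: ess_bounded_def)
    have "AE x in halfline. f x = 0" if "ess_norm f = 0"
      using esssup_AE[of "\<lambda>x. ereal \<bar>f x\<bar>" halfline] that by simp
    moreover have "ess_norm f = 0" if "AE x in halfline. f x = 0"
    proof -
      have "ess_norm f \<le> 0"
        using that meas by (intro esssup_I) auto
      with ess_norm_nonneg[of f] show ?thesis by simp
    qed
    moreover obtain r where "ess_norm f = ereal r" using ess_norm_finite[OF f] by blast
    ultimately show "real_of_ereal (ess_norm f) = 0 \<longleftrightarrow> linf_rel f (\<lambda>_. 0)"
      using f by (auto simp: linf_rel_def ess_bounded_const zero_ereal_def)
  qed
  show "norm (f + g) \<le> norm f + norm g"
  proof transfer
    fix f g assume "linf_rel f f" "linf_rel g g"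
    then have f: "ess_bounded f" and g: "ess_bounded g" by (simp_all add: linf_rel_def)
    have "ess_norm (\<lambda>x. f x + g x) \<le> esssup halfline (\<lambda>x. ereal \<bar>f x\<bar> + ereal \<bar>g x\<bar>)"
      using f g by (intro esssup_mono) (auto simp: ess_bounded_def)
    also have "\<dots> \<le> ess_norm f + ess_norm g" by (rule esssup_add)
    finally show "real_of_ereal (ess_norm (\<lambda>x. f x + g x))
        \<le> real_of_ereal (ess_norm f) + real_of_ereal (ess_norm g)"
      using ess_norm_finite[OF f] ess_norm_finite[OF g] ess_norm_finite[OF ess_bounded_add[OF f g]]
      by auto
  qed
  show "norm (a *\<^sub>R f) = \<bar>a\<bar> * norm f"
  proof transfer
    fix a :: real and f assume "linf_rel f f"
    show "real_of_ereal (ess_norm (\<lambda>x. a * f x)) = \<bar>a\<bar> * real_of_ereal (ess_norm f)"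
    proof (cases "a = 0")
      case True
      then show ?thesis
        using esssup_const[OF emeasure_halfline_nonzero, of "0::ereal"]
        by (simp add: zero_ereal_def)
    next
      case False
      then show ?thesis
        using esssup_cmult[of "\<bar>a\<bar>" halfline "\<lambda>x. ereal \<bar>f x\<bar>"] by (simp add: abs_mult)
    qed
  qed
qed

end


section \<open>The functionals\<close>

lemma indicator_measurable_halfline [measurable]:
  "indicat_real {a..b} \<in> borel_measurable halfline"
  by (intro measurable_restrict_space1 borel_measurable_indicator) simp

lemma linf_rel_integral_eq:
  assumes "linf_rel f g" "w \<in> borel_measurable halfline"
  shows "(LINT t:{a..b}|halfline. f t * w t) = (LINT t:{a..b}|halfline. g t * w t)"
  unfolding set_lebesgue_integral_def
proof (rule integral_cong_AE)
  have [measurable]: "f \<in> borel_measurable halfline" "g \<in> borel_measurable halfline"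
    using assms(1) by (auto simp: linf_rel_def ess_bounded_def)
  note [measurable] = assms(2)
  show "(\<lambda>x. indicat_real {a..b} x *\<^sub>R (f x * w x)) \<in> borel_measurable halfline"
       "(\<lambda>x. indicat_real {a..b} x *\<^sub>R (g x * w x)) \<in> borel_measurable halfline"
    by measurable
  have "AE x in halfline. f x = g x" using assms(1) by (simp add: linf_rel_def)
  then show "AE x in halfline.
      indicat_real {a..b} x *\<^sub>R (f x * w x) = indicat_real {a..b} x *\<^sub>R (g x * w x)"
    by eventually_elim simp
qed

lift_definition linf_nonneg :: "linf \<Rightarrow> bool" is "\<lambda>f. AE x in halfline. 0 \<le> f x"
proof -
  fix f g assume "linf_rel f g"
  then have "AE x in halfline. f x = g x" by (simp add: linf_rel_def)
  then have "AE x in halfline. (0 \<le> f x) = (0 \<le> g x)" by eventually_elim simp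
  then show "(AE x in halfline. 0 \<le> f x) \<longleftrightarrow> (AE x in halfline. 0 \<le> g x)"
    by (rule eventually_subst)
qed

lift_definition exp_mean :: "linf \<Rightarrow> real \<Rightarrow> real" is
  "\<lambda>f x. 1 / exp x * (LINT t:{0..x}|halfline. f t * exp t)"
proof -
  fix f g assume "linf_rel f g"
  then have "(LINT t:{0..x}|halfline. f t * exp t) = (LINT t:{0..x}|halfline. g t * exp t)" for x
    by (rule linf_rel_integral_eq)
       (intro measurable_restrict_space1 borel_measurable_continuous_onI continuous_intros
         measurable_completion, simp)
  then show "(\<lambda>x. 1 / exp x * (LINT t:{0..x}|halfline. f t * exp t)) =
      (\<lambda>x. 1 / exp x * (LINT t:{0..x}|halfline. g t * exp t))" by simp
qed

definition F0 :: "linf set" where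
  "F0 = {f. (exp_mean f \<longlongrightarrow> 0) at_top}"

definition \<D> :: "(linf \<Rightarrow>\<^sub>L real) set" where
  "\<D> = {\<phi>. (\<forall>f. linf_nonneg f \<longrightarrow> 0 \<le> blinfun_apply \<phi> f) \<and> norm \<phi> = 1 \<and>
          (\<forall>f\<in>F0. blinfun_apply \<phi> f = 0)}"

lift_definition window_mean :: "linf \<Rightarrow> real \<Rightarrow> real \<Rightarrow> real" is
  "\<lambda>f \<theta> x. 1 / \<theta> * (LINT t:{x..x + \<theta>}|halfline. f t)"
proof -
  fix f g assume "linf_rel f g"
  then have "(LINT t:{a..b}|halfline. f t) = (LINT t:{a..b}|halfline. g t)" for a b
    using linf_rel_integral_eq[of f g "\<lambda>_. 1"] by simp
  then show "(\<lambda>\<theta> x. 1 / \<theta> * (LINT t:{x..x + \<theta>}|halfline. f t)) =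
      (\<lambda>\<theta> x. 1 / \<theta> * (LINT t:{x..x + \<theta>}|halfline. g t))" by simp
qed

text \<open>\<open>Kbar\<close> takes values in \<^typ>\<open>ereal\<close>, since \<open>Limsup\<close> needs a complete lattice. The lemma
  \<open>window_limit\<close> below shows that the value is finite and that \<open>Lim\<close> denotes a genuine limit.\<close>

definition Kbar :: "linf \<Rightarrow> ereal" where
  "Kbar f = Lim (at_right 0) (\<lambda>\<theta>. Limsup at_top (\<lambda>x. ereal (window_mean f \<theta> x)))"

lemma linf_window:
  obtains G M where "0 \<le> M"
    "\<And>\<theta> x. window_mean f \<theta> x = G x (x + \<theta>) / \<theta>"
    "\<And>x y z. x \<le> y \<Longrightarrow> y \<le> z \<Longrightarrow> G x z = G x y + G y z"
    "\<And>x y. x \<le> y \<Longrightarrow> \<bar>G x y\<bar> \<le> M * (y - x)"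
proof -
  have "\<exists>G M. 0 \<le> M \<and> (\<forall>\<theta> x. window_mean f \<theta> x = G x (x + \<theta>) / \<theta>) \<and>
      (\<forall>x y z. x \<le> y \<longrightarrow> y \<le> z \<longrightarrow> G x z = G x y + G y z) \<and>
      (\<forall>x y. x \<le> y \<longrightarrow> \<bar>G x y\<bar> \<le> M * (y - x))"
  proof transfer
    fix f assume "linf_rel f f"
    then have f: "ess_bounded f" by (simp add: linf_rel_def)
    then obtain C where "AE x in halfline. \<bar>f x\<bar> \<le> C" by (auto simp: ess_bounded_def)
    then have bd: "AE x in halfline. \<bar>f x\<bar> \<le> max C 0" by eventually_elim simp
    define M where "M = max C 0"
    have M: "0 \<le> M" by (simp add: M_def)
    have meas [measurable]: "f \<in> borel_measurable halfline"
      using f by (simp add: ess_bounded_def)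
    define G where "G x y = (LINT t:{x..y}|halfline. f t)" for x y
    have fin: "emeasure halfline ({x..y} \<inter> {0..}) < \<infinity>" for x y :: real
    proof -
      have "emeasure halfline ({x..y} \<inter> {0..}) = emeasure lebesgue ({x..y} \<inter> {0..})"
        by (rule emeasure_restrict_space) auto
      also have "\<dots> \<le> emeasure lebesgue {x..y}" by (rule emeasure_mono) auto
      also have "\<dots> < \<infinity>" by (simp add: emeasure_lborel_Icc_eq)
      finally show ?thesis .
    qed
    have mle: "measure halfline ({x..y} \<inter> {0..}) \<le> y - x" if "x \<le> y" for x y :: real
    proof -
      have "measure halfline ({x..y} \<inter> {0..}) = measure lebesgue ({x..y} \<inter> {0..})"
        by (rule measure_restrict_space) auto
      also have "\<dots> \<le> measure lebesgue {x..y}"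
        by (rule measure_mono_fmeasurable) auto
      also have "\<dots> = y - x" using that by simp
      finally show ?thesis .
    qed
    have sets: "{x..y} \<inter> {0..} \<in> sets halfline" for x y :: real
      by (simp add: sets_restrict_space_iff)
    have intM: "integrable halfline (\<lambda>t. indicat_real {x..y} t * M)" for x y
    proof -
      have "integrable halfline (\<lambda>t. indicat_real ({x..y} \<inter> {0..}) t * M)"
        using sets fin by (intro integrable_mult_left integrable_real_indicator) auto
      then show ?thesis
        by (rule Bochner_Integration.integrable_cong[THEN iffD1, rotated 2])
           (auto simp: indicator_def)
    qed
    have int: "integrable halfline (\<lambda>t. indicat_real {x..y} t * f t)" for x y
    proof (rule Bochner_Integration.integrable_bound[OF intM[of x y]])
      show "(\<lambda>t. indicat_real {x..y} t * f t) \<in> borel_measurable halfline" by measurable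
      show "AE t in halfline. norm (indicat_real {x..y} t * f t) \<le> norm (indicat_real {x..y} t * M)"
        using bd by eventually_elim (auto simp: indicator_def M_def)
    qed
    have G_bd: "\<bar>G x y\<bar> \<le> M * (y - x)" if "x \<le> y" for x y
    proof -
      have "\<bar>G x y\<bar> \<le> (LINT t|halfline. \<bar>indicat_real {x..y} t * f t\<bar>)"
        unfolding G_def set_lebesgue_integral_def using integral_abs_bound by simp
      also have "\<dots> \<le> (LINT t|halfline. indicat_real {x..y} t * M)"
      proof (rule integral_mono_AE)
        show "AE t in halfline. \<bar>indicat_real {x..y} t * f t\<bar> \<le> indicat_real {x..y} t * M"
          using bd by eventually_elim (auto simp: indicator_def M_def)
      qed (use int intM in auto)
      also have "\<dots> = (LINT t|halfline. indicat_real ({x..y} \<inter> {0..}) t * M)"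
        by (rule Bochner_Integration.integral_cong) (auto simp: indicator_def)
      also have "\<dots> = measure halfline ({x..y} \<inter> {0..}) * M" by simp
      also have "\<dots> \<le> M * (y - x)"
        using mle[OF that] M by (simp add: mult.commute mult_left_mono)
      finally show ?thesis .
    qed
    have G_add: "G x z = G x y + G y z" if "x \<le> y" "y \<le> z" for x y z
    proof -
      have null: "AE t in halfline. t \<noteq> y"
      proof -
        have "AE t in lebesgue. t \<noteq> y"
          by (rule AE_I'[of "{y}"]) auto
        then show ?thesis by (subst AE_restrict_space_iff) (auto elim: eventually_mono)
      qed
      have "G x z = (LINT t|halfline. indicat_real {x..y} t * f t + indicat_real {y..z} t * f t)"
        unfolding G_def set_lebesgue_integral_def real_scaleR_def
      proof (rule integral_cong_AE)
        show "AE t in halfline. indicat_real {x..z} t * f t =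
            indicat_real {x..y} t * f t + indicat_real {y..z} t * f t"
          using null by eventually_elim (use that in \<open>auto simp: indicator_def\<close>)
      qed measurable
      then show ?thesis
        using int by (simp add: G_def set_lebesgue_integral_def)
    qed
    have G_win: "1 / \<theta> * (LINT t:{x..x + \<theta>}|halfline. f t) = G x (x + \<theta>) / \<theta>" for \<theta> x
      by (simp add: G_def)
    show "\<exists>G M. 0 \<le> M \<and>
        (\<forall>\<theta> x. 1 / \<theta> * (LINT t:{x..x + \<theta>}|halfline. f t) = G x (x + \<theta>) / \<theta>) \<and>
        (\<forall>x y z. x \<le> y \<longrightarrow> y \<le> z \<longrightarrow> G x z = G x y + G y z) \<and>
        (\<forall>x y. x \<le> y \<longrightarrow> \<bar>G x y\<bar> \<le> M * (y - x))"
      using M G_win G_add G_bd by blast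
  qed
  then show thesis using that by blast
qed

lemma window_limit:
  defines "h \<equiv> \<lambda>f \<theta>. Limsup at_top (\<lambda>x. ereal (window_mean f \<theta> x))"
  shows Kbar_tendsto: "(h f \<longlongrightarrow> Kbar f) (at_right 0)"
    and Kbar_finite: "\<bar>Kbar f\<bar> \<noteq> \<infinity>"
proof -
  obtain G M where M: "0 \<le> M"
    and W: "\<And>\<theta> x. window_mean f \<theta> x = G x (x + \<theta>) / \<theta>"
    and add: "\<And>x y z. x \<le> y \<Longrightarrow> y \<le> z \<Longrightarrow> G x z = G x y + G y z"
    and bd: "\<And>x y. x \<le> y \<Longrightarrow> \<bar>G x y\<bar> \<le> M * (y - x)"
    using linf_window[of f] by metis
  have W_bd: "\<bar>window_mean f \<theta> x\<bar> \<le> M" if "0 < \<theta>" for \<theta> x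
    using bd[of x "x + \<theta>"] that by (simp add: W abs_div divide_le_eq)
  have h_le: "h f \<theta> \<le> ereal M" if "0 < \<theta>" for \<theta>
    unfolding h_def using W_bd[OF that]
    by (intro Limsup_bounded always_eventually) (auto simp: abs_le_iff)
  have h_ge: "ereal (- M) \<le> h f \<theta>" if "0 < \<theta>" for \<theta>
  proof -
    have "ereal (- M) \<le> Liminf at_top (\<lambda>x. ereal (window_mean f \<theta> x))"
      using W_bd[OF that] by (intro Liminf_bounded always_eventually) (auto simp: abs_le_iff minus_le_iff)
    also have "\<dots> \<le> h f \<theta>"
      unfolding h_def by (rule Liminf_le_Limsup) simp
    finally show ?thesis .
  qed
  have key: "h f t \<le> ereal (c + 2 * (M + 1) * (\<theta> / t))"
    if pos: "0 < \<theta>" "0 < t" and lt: "h f \<theta> < ereal c" and "c \<le> M + 1" for \<theta> t c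
  proof -
    have c: "\<bar>c\<bar> \<le> M + 1"
      using le_less_trans[OF h_ge[OF pos(1)] lt] that(4) by simp
    obtain Y where Y: "\<And>y. y \<ge> Y \<Longrightarrow> window_mean f \<theta> y < c"
      using Limsup_lessD[OF lt[unfolded h_def]] by (auto simp: eventually_at_top_linorder)
    define n where "n = nat \<lfloor>t / \<theta>\<rfloor>"
    have n: "real n * \<theta> \<le> t" "t < real n * \<theta> + \<theta>"
    proof -
      have "real n \<le> t / \<theta>" "t / \<theta> < real n + 1"
        using pos by (auto simp: n_def)
      then show "real n * \<theta> \<le> t" "t < real n * \<theta> + \<theta>"
        using pos by (simp_all add: field_simps)
    qed
    have step: "G x (x + real k * \<theta>) \<le> real k * \<theta> * c" if "x \<ge> Y" for x k
    proof (induction k)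
      case 0
      then show ?case using bd[of x x] by simp
    next
      case (Suc k)
      have "G x (x + real (Suc k) * \<theta>) =
          G x (x + real k * \<theta>) + G (x + real k * \<theta>) (x + real k * \<theta> + \<theta>)"
        using add[of x "x + real k * \<theta>" "x + real k * \<theta> + \<theta>"] pos(1)
        by (simp add: algebra_simps)
      moreover have "G (x + real k * \<theta>) (x + real k * \<theta> + \<theta>) \<le> \<theta> * c"
      proof -
        have "window_mean f \<theta> (x + real k * \<theta>) < c"
          using \<open>x \<ge> Y\<close> pos(1) by (intro Y) (simp add: add_increasing2)
        then show ?thesis using pos(1) by (simp add: W divide_less_eq mult.commute)
      qed
      ultimately show ?case using Suc by (simp add: algebra_simps)
    qed
    have "window_mean f t x \<le> c + 2 * (M + 1) * (\<theta> / t)" if "x \<ge> Y" for x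
    proof -
      have "G x (x + t) = G x (x + real n * \<theta>) + G (x + real n * \<theta>) (x + t)"
        using n pos(1) by (intro add) auto
      also have "G x (x + real n * \<theta>) \<le> real n * \<theta> * c" by (rule step[OF that])
      also have "G (x + real n * \<theta>) (x + t) \<le> M * \<theta>"
      proof -
        have "G (x + real n * \<theta>) (x + t) \<le> M * (t - real n * \<theta>)"
          using bd[of "x + real n * \<theta>" "x + t"] n by simp
        also have "\<dots> \<le> M * \<theta>" using M n by (intro mult_left_mono) auto
        finally show ?thesis .
      qed
      also have "real n * \<theta> * c \<le> t * c + (M + 1) * \<theta>"
      proof -
        have "(t - real n * \<theta>) * (- c) \<le> \<theta> * (M + 1)"
          using n c M by (intro order_trans[OF mult_left_mono[of "- c" "M + 1"] mult_right_mono]) auto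
        then show ?thesis by (simp add: algebra_simps)
      qed
      finally have "G x (x + t) \<le> t * c + 2 * (M + 1) * \<theta>"
        using pos(1) by (simp add: algebra_simps)
      then show ?thesis using pos(2) by (simp add: W field_simps)
    qed
    then show ?thesis
      unfolding h_def
      by (intro Limsup_bounded) (auto simp: eventually_at_top_linorder)
  qed
  \<comment> \<open>by additivity of the integral over windows, the limit is the supremum over \<open>\<theta> > 0\<close>\<close>
  define S where "S = (SUP t\<in>{0<..}. h f t)"
  have S: "S \<le> ereal M" "ereal (- M) \<le> S"
    unfolding S_def using h_le h_ge[of 1] by (auto intro: SUP_least SUP_upper2[of 1])
  have "(h f \<longlongrightarrow> S) (at_right 0)"
  proof (rule order_tendstoI)
    fix a assume "a < S"
    then obtain t where t: "0 < t" "a < h f t" by (auto simp: S_def less_SUP_iff)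
    obtain b where b: "a < ereal b" "ereal b < h f t"
      using ereal_dense2[OF t(2)] by blast
    have b_le: "b < M" using less_le_trans[OF b(2) h_le[OF t(1)]] by simp
    obtain a' where a': "a < ereal a'" "a' < b"
      using ereal_dense2[OF b(1)] by auto
    define d where "d = t * (b - a') / (2 * (M + 1))"
    have d: "0 < d" using t a' M by (simp add: d_def)
    have "a < h f \<theta>" if "0 < \<theta>" "\<theta> < d" for \<theta>
    proof (rule ccontr)
      assume "\<not> a < h f \<theta>"
      then have "h f \<theta> < ereal a'" using a' by (auto intro: le_less_trans)
      then have "h f t \<le> ereal (a' + 2 * (M + 1) * (\<theta> / t))"
        using a' b_le that t by (intro key) auto
      also have "\<dots> \<le> ereal b"
      proof -
        have "\<theta> * (2 * (M + 1)) < t * (b - a')"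
          using that M by (simp add: d_def pos_less_divide_eq)
        then show ?thesis using t by (simp add: field_simps)
      qed
      finally show False using b(2) by simp
    qed
    then show "eventually (\<lambda>\<theta>. a < h f \<theta>) (at_right 0)"
      using d by (auto simp: eventually_at_right_field)
  next
    fix a assume a: "S < a"
    have "h f \<theta> < a" if "0 < \<theta>" for \<theta>
    proof -
      have "h f \<theta> \<le> S" unfolding S_def using that by (intro SUP_upper) simp
      then show ?thesis using a by simp
    qed
    then show "eventually (\<lambda>\<theta>. h f \<theta> < a) (at_right 0)"
      by (auto simp: eventually_at_right_field intro: exI[of _ 1])
  qed
  moreover from this have "Kbar f = S"
    unfolding Kbar_def h_def by (intro tendsto_Lim) auto
  ultimately show "(h f \<longlongrightarrow> Kbar f) (at_right 0)" and "\<bar>Kbar f\<bar> \<noteq> \<infinity>"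
    using S by auto
qed

end

theory Submission
  imports Defs
begin

text \<open>A function lies in \<open>F0\<close> exactly when it is almost everywhere \<open>u + u'\<close> with \<open>u = exp_mean f\<close>
  Lipschitz and vanishing at infinity; hence its mean over each fixed window tends to \<open>0\<close>.
  So \<open>Kbar\<close> is a sublinear functional that is nonpositive on \<open>F0\<close>, and every linear functional it
  dominates lies in \<open>\<D>\<close>; Hahn--Banach provides one that attains \<open>Kbar f\<close> at \<open>f\<close>.
  Conversely, let \<open>c > Kbar f\<close>. Partition a half line into blocks whose lengths tend to \<open>0\<close> so slowly
  that the mean of \<open>f\<close> over each block is at most \<open>c\<close>, and let \<open>a\<close> be the function of block means. The
  primitive of \<open>a - f\<close> converges at infinity, which puts \<open>a - f\<close> into \<open>F0\<close>, so that
  \<open>\<phi> f = \<phi> a \<le> c\<close> for every \<open>\<phi>\<close> in \<open>\<D>\<close>.\<close>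

section \<open>Sublinear functionals\<close>

definition sublinear :: "('a::real_vector \<Rightarrow> real) \<Rightarrow> bool" where
  "sublinear p \<longleftrightarrow> (\<forall>x y. p (x + y) \<le> p x + p y) \<and> (\<forall>c\<ge>0. \<forall>x. p (c *\<^sub>R x) = c * p x)"

text \<open>Applying the one-sided bound with factor \<open>1 / c\<close> at
  \<open>c *\<^sub>R x\<close> yields the reverse bound.\<close>

lemma sublinearI:
  assumes "\<And>x y. p (x + y) \<le> p x + p y" "\<And>c x. 0 < c \<Longrightarrow> p (c *\<^sub>R x) \<le> c * p x" "p 0 = 0"
  shows "sublinear p"
  unfolding sublinear_def
proof (intro conjI allI impI)
  fix c :: real and x assume "0 \<le> c"
  show "p (c *\<^sub>R x) = c * p x"
  proof (cases "c = 0")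
    case False
    with \<open>0 \<le> c\<close> have c: "0 < c" by simp
    have "p x = p ((1 / c) *\<^sub>R (c *\<^sub>R x))" using c by simp
    also have "\<dots> \<le> (1 / c) * p (c *\<^sub>R x)" using c by (intro assms) simp
    finally have "c * p x \<le> p (c *\<^sub>R x)" using c by (simp add: field_simps)
    with assms(2)[OF c, of x] show ?thesis by simp
  qed (use assms in simp)
qed (rule assms)

lemma sublinear_add: "sublinear p \<Longrightarrow> p (x + y) \<le> p x + p y"
  by (simp add: sublinear_def)

lemma sublinear_scale: "sublinear p \<Longrightarrow> 0 \<le> c \<Longrightarrow> p (c *\<^sub>R x) = c * p x"
  by (simp add: sublinear_def)

lemma sublinear_0: "sublinear p \<Longrightarrow> p 0 = 0"
  using sublinear_scale[of p 0 0] by simp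

lemma sublinear_neg: "sublinear p \<Longrightarrow> - p (- x) \<le> p x"
  using sublinear_add[of p x "- x"] sublinear_0[of p] by simp

text \<open>For sublinear \<open>p\<close> this is the largest sublinear functional
  \<open>q \<le> p\<close> with \<open>q (- f) \<le> - p f\<close>.\<close>

definition sublinear_shift :: "('a::real_vector \<Rightarrow> real) \<Rightarrow> 'a \<Rightarrow> 'a \<Rightarrow> real" where
  "sublinear_shift p f x = (INF t\<in>{0..}. p (x + t *\<^sub>R f) - t * p f)"

context
  fixes p :: "'a::real_vector \<Rightarrow> real" and f :: 'a
  assumes p: "sublinear p"
begin

text \<open>Writing \<open>t *\<^sub>R f\<close> as \<open>(x + t *\<^sub>R f) + (- x)\<close>
  bounds every term below by \<open>- p (- x)\<close>, so the real infimum is meaningful.\<close>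

lemma sublinear_shift_bdd: "bdd_below ((\<lambda>t. p (x + t *\<^sub>R f) - t * p f) ` {0..})"
proof (rule bdd_belowI2)
  fix t :: real assume "t \<in> {0..}"
  then have "t * p f \<le> p (x + t *\<^sub>R f) + p (- x)"
    using sublinear_add[OF p, of "x + t *\<^sub>R f" "- x"] sublinear_scale[OF p, of t f] by simp
  then show "- p (- x) \<le> p (x + t *\<^sub>R f) - t * p f" by simp
qed

lemma sublinear_shift_le: "0 \<le> t \<Longrightarrow> sublinear_shift p f x \<le> p (x + t *\<^sub>R f) - t * p f"
  unfolding sublinear_shift_def by (intro cINF_lower sublinear_shift_bdd) simp

lemma le_sublinear_shift:
  "(\<And>t. 0 \<le> t \<Longrightarrow> a \<le> p (x + t *\<^sub>R f) - t * p f) \<Longrightarrow> a \<le> sublinear_shift p f x"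
  unfolding sublinear_shift_def by (intro cINF_greatest) auto

lemma sublinear_shift_le_self: "sublinear_shift p f x \<le> p x"
  using sublinear_shift_le[of 0 x] by simp

lemma sublinear_shift_neg: "sublinear_shift p f (- f) \<le> - p f"
  using sublinear_shift_le[of 1 "- f"] sublinear_0[OF p] by simp

lemma sublinear_sublinear_shift: "sublinear (sublinear_shift p f)"
proof (rule sublinearI)
  fix x y
  \<comment> \<open>The parameter \<open>s + t\<close> at \<open>x + y\<close> splits into
    \<open>s\<close> at \<open>x\<close> and \<open>t\<close> at \<open>y\<close>; the infima over
    \<open>s\<close> and \<open>t\<close> are then taken one after the other.\<close>
  have *: "sublinear_shift p f (x + y) \<le> (p (x + s *\<^sub>R f) - s * p f) + (p (y + t *\<^sub>R f) - t * p f)"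
    if "0 \<le> s" "0 \<le> t" for s t
    using sublinear_shift_le[of "s + t" "x + y"] that
      sublinear_add[OF p, of "x + s *\<^sub>R f" "y + t *\<^sub>R f"]
    by (simp add: algebra_simps)
  have "sublinear_shift p f (x + y) - (p (y + t *\<^sub>R f) - t * p f) \<le> sublinear_shift p f x"
    if "0 \<le> t" for t
    using *[OF _ that] by (intro le_sublinear_shift) (simp add: algebra_simps)
  then have "sublinear_shift p f (x + y) - sublinear_shift p f x \<le> sublinear_shift p f y"
    by (intro le_sublinear_shift) (simp add: algebra_simps)
  then show "sublinear_shift p f (x + y) \<le> sublinear_shift p f x + sublinear_shift p f y" by simp
next
  fix c :: real and x assume c: "0 < c"
  have "sublinear_shift p f (c *\<^sub>R x) / c \<le> sublinear_shift p f x"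
  proof (rule le_sublinear_shift)
    fix t :: real assume t: "0 \<le> t"
    \<comment> \<open>Rescaling the parameter to \<open>c * t\<close> lets \<open>c\<close> factor
      out of \<open>p\<close>.\<close>
    have "sublinear_shift p f (c *\<^sub>R x) \<le> p (c *\<^sub>R (x + t *\<^sub>R f)) - c * t * p f"
      using sublinear_shift_le[of "c * t" "c *\<^sub>R x"] c t by (simp add: scaleR_add_right)
    also have "\<dots> = c * (p (x + t *\<^sub>R f) - t * p f)"
      using sublinear_scale[OF p, of c "x + t *\<^sub>R f"] c by (simp only: less_imp_le[OF c] scaleR_add_right right_diff_distrib mult.assoc)
    finally show "sublinear_shift p f (c *\<^sub>R x) / c \<le> p (x + t *\<^sub>R f) - t * p f"
      using c by (simp add: field_simps)
  qed
  then show "sublinear_shift p f (c *\<^sub>R x) \<le> c * sublinear_shift p f x"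
    using c by (simp add: field_simps)
next
  show "sublinear_shift p f 0 = 0"
    using sublinear_shift_le_self[of 0] le_sublinear_shift[of 0 0] sublinear_0[OF p] sublinear_scale[OF p]
    by (intro antisym) simp_all
qed

end

text \<open>Of two members of a chain one lies below both, and its subadditivity bounds the infimum
  at \<open>x + y\<close> by the value of one at \<open>x\<close> plus that of the other at
  \<open>y\<close>.\<close>

lemma Inf_chain_sublinear:
  fixes C :: "('a::real_vector \<Rightarrow> real) set"
  assumes C: "C \<noteq> {}" "\<And>q. q \<in> C \<Longrightarrow> sublinear q"
    and chain: "\<And>q r. q \<in> C \<Longrightarrow> r \<in> C \<Longrightarrow> q \<le> r \<or> r \<le> q"
    and bdd: "\<And>x. bdd_below ((\<lambda>q. q x) ` C)"
  shows "sublinear (\<lambda>x. INF q\<in>C. q x)"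
proof (rule sublinearI)
  let ?I = "\<lambda>x. INF q\<in>C. q x"
  have low: "?I x \<le> q x" if "q \<in> C" for q x
    using bdd that by (rule cINF_lower)
  fix x y
  have *: "?I (x + y) \<le> q x + r y" if qr: "q \<in> C" "r \<in> C" for q r
  proof -
    obtain s where "s \<in> C" "s \<le> q" "s \<le> r" using chain[OF qr] qr by blast
    then have "?I (x + y) \<le> s (x + y)" "s (x + y) \<le> s x + s y" "s x \<le> q x" "s y \<le> r y"
      using low sublinear_add[OF C(2)] by (auto simp: le_fun_def)
    then show ?thesis by linarith
  qed
  have "?I (x + y) - r y \<le> ?I x" if "r \<in> C" for r
    using C(1) *[OF _ that] by (intro cINF_greatest) (auto simp: algebra_simps)
  then have "?I (x + y) - ?I x \<le> ?I y"
    using C(1) by (intro cINF_greatest) (auto simp: algebra_simps)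
  then show "?I (x + y) \<le> ?I x + ?I y" by simp
next
  let ?I = "\<lambda>x. INF q\<in>C. q x"
  fix c :: real and x assume c: "0 < c"
  have "?I (c *\<^sub>R x) / c \<le> ?I x"
  proof (rule cINF_greatest[OF C(1)])
    fix q assume q: "q \<in> C"
    have "?I (c *\<^sub>R x) \<le> q (c *\<^sub>R x)" using bdd q by (rule cINF_lower)
    then show "?I (c *\<^sub>R x) / c \<le> q x"
      using c sublinear_scale[OF C(2)[OF q], of c x] by (simp add: field_simps)
  qed
  then show "?I (c *\<^sub>R x) \<le> c * ?I x" using c by (simp add: field_simps)
next
  have "(\<lambda>q. q 0) ` C = {0}" using C sublinear_0 by force
  then show "(INF q\<in>C. q 0) = 0" by simp
qed

text \<open>A minimal sublinear functional is linear, because it coincides with each of its shifts. Shifting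
  \<open>p\<close> in direction \<open>f\<close> first forces \<open>\<phi> (- f) \<le> - p f\<close>.\<close>

theorem hahn_banach_sublinear:
  fixes p :: "'a::real_vector \<Rightarrow> real"
  assumes p: "sublinear p"
  obtains \<phi> where "linear \<phi>" "\<And>x. \<phi> x \<le> p x" "\<phi> f = p f"
proof -
  define p0 where "p0 = sublinear_shift p f"
  have p0: "sublinear p0" unfolding p0_def by (rule sublinear_sublinear_shift[OF p])
  define A where "A = {q. sublinear q \<and> q \<le> p0}"
  \<comment> \<open>Zorn's lemma for the reversed order: maximality becomes pointwise minimality,
    and a nonempty chain is bounded by its pointwise infimum.\<close>
  have "\<exists>m\<in>A. \<forall>q\<in>A. q \<le> m \<longrightarrow> q = m"
  proof (rule predicate_Zorn)
    show "partial_order_on A (relation_of (\<lambda>q r. r \<le> q) A)"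
      by (rule partial_order_on_relation_ofI) auto
  next
    fix C assume "C \<in> Chains (relation_of (\<lambda>q r. r \<le> q) A)"
    then have CA: "C \<subseteq> A" and chain: "\<And>q r. q \<in> C \<Longrightarrow> r \<in> C \<Longrightarrow> q \<le> r \<or> r \<le> q"
      by (auto simp: Chains_def relation_of_def)
    show "\<exists>u\<in>A. \<forall>q\<in>C. u \<le> q"
    proof (cases "C = {}")
      case True
      then show ?thesis using p0 by (auto simp: A_def)
    next
      case False
      \<comment> \<open>From \<open>0 \<le> q x + q (- x)\<close> and \<open>q \<le> p0\<close>, all
        members share the lower bound \<open>- p0 (- x)\<close> at \<open>x\<close>.\<close>
      have bdd: "bdd_below ((\<lambda>q. q x) ` C)" for x
      proof (rule bdd_belowI2)
        fix q assume "q \<in> C"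
        then have "sublinear q" "q (- x) \<le> p0 (- x)" using CA by (auto simp: A_def le_fun_def)
        then show "- p0 (- x) \<le> q x" using sublinear_neg[of q x] by simp
      qed
      let ?I = "\<lambda>x. INF q\<in>C. q x"
      have low: "?I \<le> q" if "q \<in> C" for q
        unfolding le_fun_def using bdd that by (intro allI cINF_lower)
      have "sublinear ?I"
        using False CA chain bdd by (intro Inf_chain_sublinear) (auto simp: A_def)
      moreover obtain q where "q \<in> C" using False by blast
      with CA have "q \<le> p0" by (auto simp: A_def)
      with low[OF \<open>q \<in> C\<close>] have "?I \<le> p0" by (rule order_trans)
      ultimately have "?I \<in> A" by (simp add: A_def)
      with low show ?thesis by blast
    qed
  qed
  then obtain m where m: "sublinear m" "m \<le> p0"
    and minimal: "\<And>q. sublinear q \<Longrightarrow> q \<le> m \<Longrightarrow> q = m"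
    by (auto simp: A_def intro: order_trans)
  \<comment> \<open>Oddness is all that is missing for linearity: applied to negatives, it reverses
    subadditivity and extends homogeneity to negative scalars.\<close>
  have neg: "m (- y) = - m y" for y
  proof -
    have "sublinear_shift m y = m"
      using m(1) by (intro minimal sublinear_sublinear_shift) (auto simp: le_fun_def sublinear_shift_le_self)
    then have "m (- y) \<le> - m y" using sublinear_shift_neg[OF m(1), of y] by simp
    with sublinear_neg[OF m(1), of y] show ?thesis by simp
  qed
  have "linear m"
  proof (rule linearI)
    fix x y
    show "m (x + y) = m x + m y"
      using sublinear_add[OF m(1), of x y] sublinear_add[OF m(1), of "- x" "- y"] neg[of x] neg[of y]
        neg[of "x + y"] by simp
  next
    fix c :: real and x
    show "m (c *\<^sub>R x) = c *\<^sub>R m x"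
      using sublinear_scale[OF m(1), of c x] sublinear_scale[OF m(1), of "- c" x] neg[of "c *\<^sub>R x"]
      by (cases "0 \<le> c") auto
  qed
  moreover have le: "m x \<le> p x" for x
    using m(2) sublinear_shift_le_self[OF p, of f x] by (auto simp: p0_def le_fun_def intro: order_trans)
  moreover have "m f = p f"
  proof (rule antisym[OF le])
    have "m (- f) \<le> - p f"
      using m(2) sublinear_shift_neg[OF p, of f] by (auto simp: p0_def le_fun_def intro: order_trans)
    then show "p f \<le> m f" by (simp add: neg)
  qed
  ultimately show thesis using that by blast
qed

section \<open>Integrals of bounded functions\<close>

text \<open>Values beyond the essential bound are cut to 0, a change on a null set only. A bound
  valid everywhere lets integrals be estimated pointwise.\<close>

lemma linf_bounded_representative:
  obtains h C where "f = abs_linf h" "h \<in> borel_measurable halfline" "\<And>x. \<bar>h x\<bar> \<le> C"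
proof -
  have r: "linf_rel (rep_linf f) (rep_linf f)"
    using Quotient_rep_reflp[OF Quotient_linf] .
  then have [measurable]: "rep_linf f \<in> borel_measurable halfline"
    by (simp add: linf_rel_def ess_bounded_def)
  from r obtain C where C: "AE x in halfline. \<bar>rep_linf f x\<bar> \<le> C"
    by (auto simp: linf_rel_def ess_bounded_def)
  define h where "h x = (if \<bar>rep_linf f x\<bar> \<le> C then rep_linf f x else 0)" for x
  have hm: "h \<in> borel_measurable halfline" unfolding h_def by measurable
  have hb: "\<bar>h x\<bar> \<le> max C 0" for x by (auto simp: h_def)
  have "AE x in halfline. rep_linf f x = h x" using C by eventually_elim (simp add: h_def)
  with r hm hb have "linf_rel (rep_linf f) h" by (auto simp: linf_rel_def ess_bounded_def)
  then have "f = abs_linf h"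
    using Quotient_rel_abs[OF Quotient_linf] Quotient_abs_rep[OF Quotient_linf] by metis
  with hm hb show thesis using that by blast
qed

lemma linf_relI_bounded:
  "h \<in> borel_measurable halfline \<Longrightarrow> (\<And>x. \<bar>h x\<bar> \<le> C) \<Longrightarrow> linf_rel h h"
  by (auto simp: linf_rel_def ess_bounded_def)

text \<open>Covers both weights in use, \<open>w = 1\<close> for window means and
  \<open>w = exp\<close> for \<open>exp_mean\<close>. Absolute integrability is what identifies
  Lebesgue and gauge integrals.\<close>

lemma halfline_absolutely_integrable:
  fixes h :: "real \<Rightarrow> real"
  assumes h: "h \<in> borel_measurable halfline" "\<And>x. \<bar>h x\<bar> \<le> C"
    and w: "continuous_on {a..b} w" and a: "0 \<le> a"
  shows "(\<lambda>t. h t * w t) absolutely_integrable_on {a..b}"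
proof -
  have "bounded (w ` {a..b})"
    by (intro compact_imp_bounded compact_continuous_image w) simp
  then obtain B where B: "\<And>t. t \<in> {a..b} \<Longrightarrow> \<bar>w t\<bar> \<le> B"
    unfolding bounded_iff by (metis imageI real_norm_def)
  show ?thesis
  proof (rule measurable_bounded_by_integrable_imp_absolutely_integrable[where g = "\<lambda>_. C * B"])
    have "h \<in> borel_measurable (lebesgue_on {a..b})"
      using h(1) a by (auto intro: measurable_restrict_mono)
    moreover have "w \<in> borel_measurable (lebesgue_on {a..b})"
      using w by (auto intro: continuous_imp_measurable_on_sets_lebesgue)
    ultimately show "(\<lambda>t. h t * w t) \<in> borel_measurable (lebesgue_on {a..b})" by measurable
  next
    fix t assume "t \<in> {a..b}"
    then show "norm (h t * w t) \<le> C * B"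
      using h(2)[of t] B[of t] by (auto simp: abs_mult intro!: mult_mono)
  qed auto
qed

lemma halfline_integrable:
  fixes h :: "real \<Rightarrow> real"
  assumes "h \<in> borel_measurable halfline" "\<And>x. \<bar>h x\<bar> \<le> C" "0 \<le> a"
  shows "h absolutely_integrable_on {a..b}" "h integrable_on {a..b}"
  using halfline_absolutely_integrable[OF assms(1,2) continuous_on_const assms(3), of b 1]
    set_lebesgue_integral_eq_integral(1) by auto

text \<open>Passes from the Lebesgue integrals of the definitions to gauge integrals, where
  intervals are split and calculus is done.\<close>

lemma halfline_integral:
  fixes k :: "real \<Rightarrow> real"
  assumes "k absolutely_integrable_on {a..b}" "0 \<le> a"
  shows "(LINT t:{a..b}|halfline. k t) = integral {a..b} k"
proof -
  have "(LINT t:{a..b}|halfline. k t) = (LINT t:{a..b}|lebesgue. k t)"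
    unfolding set_lebesgue_integral_def
    by (subst integral_restrict_space)
      (use assms(2) in \<open>auto intro!: Bochner_Integration.integral_cong simp: indicator_def\<close>)
  then show ?thesis using set_lebesgue_integral_eq_integral(2)[OF assms(1)] by simp
qed

lemma window_mean_abs_linf:
  fixes h :: "real \<Rightarrow> real"
  assumes h: "h \<in> borel_measurable halfline" "\<And>x. \<bar>h x\<bar> \<le> C" and "0 \<le> x"
  shows "window_mean (abs_linf h) \<theta> x = integral {x..x + \<theta>} h / \<theta>"
  using halfline_integral[OF halfline_integrable(1)[OF h]] assms(3)
  by (simp add: window_mean.abs_eq[OF linf_relI_bounded[OF h]])

lemma exp_mean_abs_linf:
  fixes h :: "real \<Rightarrow> real"
  assumes h: "h \<in> borel_measurable halfline" "\<And>x. \<bar>h x\<bar> \<le> C"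
  shows "exp_mean (abs_linf h) x = integral {0..x} (\<lambda>t. h t * exp t) / exp x"
  using halfline_integral[OF halfline_absolutely_integrable[OF h, of 0 x exp]]
  by (simp add: exp_mean.abs_eq[OF linf_relI_bounded[OF h]] continuous_on_exp)

section \<open>Integration by parts for the primitive of a bounded function\<close>

lemma abs_integral_le:
  fixes k :: "real \<Rightarrow> real"
  assumes "k integrable_on {x..y}" "x \<le> y" "\<And>t. t \<in> {x..y} \<Longrightarrow> \<bar>k t\<bar> \<le> M"
  shows "\<bar>integral {x..y} k\<bar> \<le> M * (y - x)"
  using integral_norm_bound_integral[of k "{x..y}" "\<lambda>_. M"] integrable_const_ivl[of M x y] assms
  by (simp add: mult.commute)

text \<open>The difference quotients of \<open>D\<close> are at most
  \<open>K * \<bar>y - x\<bar>\<close> in absolute value, so the derivative is 0 at every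
  point.\<close>

lemma constant_on_of_quadratic_modulus:
  fixes D :: "real \<Rightarrow> real"
  assumes D: "\<And>x y. a \<le> x \<Longrightarrow> x \<le> y \<Longrightarrow> y \<le> b \<Longrightarrow> \<bar>D y - D x\<bar> \<le> K * (y - x)\<^sup>2" and "a \<le> b"
  shows "D b = D a"
proof -
  have "(D has_field_derivative 0) (at x within {a..b})" if x: "x \<in> {a..b}" for x
    unfolding has_field_derivative_iff
  proof (rule Lim_null_comparison)
    have "norm ((D y - D x) / (y - x)) \<le> K * \<bar>y - x\<bar>" if "y \<in> {a..b}" "y \<noteq> x" for y
    proof -
      have "\<bar>D y - D x\<bar> \<le> K * \<bar>y - x\<bar>\<^sup>2"
      proof (cases "x \<le> y")
        case True
        then show ?thesis using D[of x y] x that by simp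
      next
        case False
        then show ?thesis using D[of y x] x that by (simp add: abs_minus_commute power2_commute)
      qed
      then show ?thesis using that by (simp add: divide_le_eq power2_eq_square mult.assoc)
    qed
    then show "\<forall>\<^sub>F y in at x within {a..b}. norm ((D y - D x) / (y - x)) \<le> K * \<bar>y - x\<bar>"
      by (auto simp: eventually_at_filter)
    have "((\<lambda>y. K * \<bar>y - x\<bar>) \<longlongrightarrow> K * \<bar>x - x\<bar>) (at x within {a..b})"
      by (intro tendsto_intros)
    then show "((\<lambda>y. K * \<bar>y - x\<bar>) \<longlongrightarrow> 0) (at x within {a..b})" by simp
  qed
  then have "\<exists>c. \<forall>x\<in>{a..b}. D x = c"
    by (intro has_field_derivative_zero_constant) auto
  with \<open>a \<le> b\<close> show ?thesis by auto
qed

text \<open>The library version of integration by parts needs both factors to be differentiable off a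
  countable set, which the primitive of a merely measurable function need not be.\<close>

lemma integral_by_parts_primitive:
  fixes h w w' :: "real \<Rightarrow> real"
  assumes h: "h integrable_on {a..b}" "\<And>t. t \<in> {a..b} \<Longrightarrow> \<bar>h t\<bar> \<le> C"
    and hw: "(\<lambda>t. h t * w t) integrable_on {a..b}"
    and w: "\<And>t. t \<in> {a..b} \<Longrightarrow> (w has_real_derivative w' t) (at t within {a..b})"
    and w': "continuous_on {a..b} w'" and ab: "a \<le> b"
  shows "integral {a..b} (\<lambda>t. h t * w t) =
    integral {a..b} h * w b - integral {a..b} (\<lambda>t. integral {a..t} h * w' t)"
proof -
  have "bounded (w' ` {a..b})"
    by (intro compact_imp_bounded compact_continuous_image w') simp
  then obtain B where B: "\<And>t. t \<in> {a..b} \<Longrightarrow> \<bar>w' t\<bar> \<le> B"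
    unfolding bounded_iff by (metis imageI real_norm_def)
  define H where "H x = integral {a..x} h" for x
  have Hc: "continuous_on {a..b} H" unfolding H_def
    by (rule indefinite_integral_continuous_1[OF h(1)])
  have Hw': "(\<lambda>t. H t * w' t) integrable_on {x..y}" if "a \<le> x" "y \<le> b" for x y
    using that by (intro integrable_continuous_real continuous_on_mult
        continuous_on_subset[OF Hc] continuous_on_subset[OF w']) auto
  \<comment> \<open>The defect of the formula on \<open>{a..x}\<close>. It is 0 at \<open>a\<close>,
    so constancy suffices.\<close>
  define D where "D x = integral {a..x} (\<lambda>t. h t * w t) - H x * w x
      + integral {a..x} (\<lambda>t. H t * w' t)" for x
  have sub: "k integrable_on {x..y}" if "k integrable_on {a..b}" "a \<le> x" "y \<le> b" for k :: "real \<Rightarrow> real" and x y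
    using that by (intro integrable_subinterval_real[OF that(1)]) auto
  have split: "integral {a..y} k = integral {a..x} k + integral {x..y} k"
    if "k integrable_on {a..b}" "a \<le> x" "x \<le> y" "y \<le> b" for k :: "real \<Rightarrow> real" and x y
    using that Henstock_Kurzweil_Integration.integral_combine[of a x y k] sub[of k a y] by simp
  have "D b = D a"
  proof (rule constant_on_of_quadratic_modulus[OF _ ab])
    fix x y assume xy: "a \<le> x" "x \<le> y" "y \<le> b"
    have FTC: "(w' has_integral w v - w u) {u..v}" if "a \<le> u" "u \<le> v" "v \<le> b" for u v
      using that by (intro fundamental_theorem_of_calculus)
        (auto simp: has_real_derivative_iff_has_vector_derivative[symmetric] intro: DERIV_subset[OF w])
    have HC: "\<bar>H t - H x\<bar> \<le> C * (t - x)" if "x \<le> t" "t \<le> y" for t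
      using split[OF h(1), of x t] abs_integral_le[of h x t C] sub[OF h(1), of x t] h(2) xy that by (simp add: H_def)
    have wB: "\<bar>w t - w y\<bar> \<le> B * (y - t)" if "x \<le> t" "t \<le> y" for t
      using FTC[of t y] abs_integral_le[of w' t y B] B xy that
      by (auto simp: integral_unique has_integral_integrable abs_minus_commute)
    have i1: "(\<lambda>t. h t * w t) integrable_on {x..y}" and i2: "h integrable_on {x..y}"
      and i3: "(\<lambda>t. H t * w' t) integrable_on {x..y}" and i4: "w' integrable_on {x..y}"
      using sub[OF hw] sub[OF h(1)] Hw' FTC[OF xy, THEN has_integral_integrable] xy by auto
    \<comment> \<open>The increment of \<open>H * w\<close> is split as
      \<open>(H y - H x) * w y + H x * (w y - w x)\<close>, so that each piece pairs with one
      integral and leaves an integrand made of increments of \<open>w\<close> and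
      \<open>H\<close>.\<close>
    have "D y - D x = integral {x..y} (\<lambda>t. h t * w t) - (H y - H x) * w y - H x * (w y - w x)
        + integral {x..y} (\<lambda>t. H t * w' t)"
      using split[OF hw xy] split[OF Hw' xy] by (simp add: D_def algebra_simps)
    also have "H y - H x = integral {x..y} h" using split[OF h(1) xy] by (simp add: H_def)
    also have "w y - w x = integral {x..y} w'" using FTC[OF xy] by (simp add: integral_unique)
    also have "integral {x..y} (\<lambda>t. h t * w t) - integral {x..y} h * w y - H x * integral {x..y} w'
        + integral {x..y} (\<lambda>t. H t * w' t)
      = integral {x..y} (\<lambda>t. (h t * w t - h t * w y) + (H t * w' t - H x * w' t))"
      using i1 i2 i3 i4
      by (simp add: integral_add integral_diff integrable_add integrable_diff
          integrable_on_mult_left integrable_on_mult_right)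
    finally have eq: "D y - D x =
      integral {x..y} (\<lambda>t. (h t * w t - h t * w y) + (H t * w' t - H x * w' t))" .
    \<comment> \<open>\<open>w\<close> and \<open>H\<close> are Lipschitz with constants
      \<open>B\<close> and \<open>C\<close>, so the integrand is of order \<open>y - x\<close> and
      its integral of order \<open>(y - x)\<^sup>2\<close>.\<close>
    have "\<bar>(h t * w t - h t * w y) + (H t * w' t - H x * w' t)\<bar> \<le> 2 * C * B * (y - x)"
      if t: "t \<in> {x..y}" for t
    proof -
      have C: "0 \<le> C" and Bp: "0 \<le> B" using h(2)[of t] B[of t] xy t by force+
      have "\<bar>h t * w t - h t * w y\<bar> = \<bar>h t\<bar> * \<bar>w t - w y\<bar>"
        by (simp add: abs_mult[symmetric] right_diff_distrib)
      also have "\<dots> \<le> C * (B * (y - x))"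
        using wB[of t] h(2)[of t] xy t C Bp
        by (intro mult_mono order_trans[OF wB] mult_left_mono) auto
      finally have 1: "\<bar>h t * w t - h t * w y\<bar> \<le> C * (B * (y - x))" .
      have "\<bar>H t * w' t - H x * w' t\<bar> = \<bar>H t - H x\<bar> * \<bar>w' t\<bar>"
        by (simp add: abs_mult[symmetric] left_diff_distrib)
      also have "\<dots> \<le> (C * (y - x)) * B"
        using B[of t] xy t C Bp
        by (intro mult_mono order_trans[OF HC] mult_left_mono) auto
      finally have 2: "\<bar>H t * w' t - H x * w' t\<bar> \<le> C * (B * (y - x))" by (simp add: mult_ac)
      show ?thesis using 1 2 by linarith
    qed
    moreover have "(\<lambda>t. (h t * w t - h t * w y) + (H t * w' t - H x * w' t)) integrable_on {x..y}"
      using i1 i2 i3 i4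
      by (intro integrable_add integrable_diff integrable_on_mult_left integrable_on_mult_right)
    ultimately have "\<bar>D y - D x\<bar> \<le> 2 * C * B * (y - x) * (y - x)"
      unfolding eq using xy(2) by (intro abs_integral_le)
    then show "\<bar>D y - D x\<bar> \<le> 2 * C * B * (y - x)\<^sup>2" by (simp add: power2_eq_square mult.assoc)
  qed
  then show ?thesis by (simp add: D_def H_def)
qed

section \<open>The subspace \<open>F0\<close>\<close>

lemma exp_mean_continuous:
  assumes h: "h \<in> borel_measurable halfline" "\<And>x. \<bar>h x\<bar> \<le> C"
  shows "continuous_on {0..x} (exp_mean (abs_linf h))"
proof -
  have "(\<lambda>t. h t * exp t) integrable_on {0..x}"
    using halfline_absolutely_integrable[OF h, of 0 x exp] set_lebesgue_integral_eq_integral(1)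
    by (auto simp: continuous_on_exp)
  then have "continuous_on {0..x} (\<lambda>y. integral {0..y} (\<lambda>t. h t * exp t) / exp y)"
    by (intro continuous_intros indefinite_integral_continuous_1) auto
  then show ?thesis using exp_mean_abs_linf[OF h] by (simp cong: continuous_on_cong)
qed

text \<open>The mean \<open>u = exp_mean f\<close> solves \<open>u + u' = f\<close> almost everywhere; this is the integrated form.\<close>

lemma integral_eq_exp_mean:
  assumes h: "h \<in> borel_measurable halfline" "\<And>x. \<bar>h x\<bar> \<le> C" and x: "0 \<le> x"
  defines "u \<equiv> exp_mean (abs_linf h)"
  shows "integral {0..x} h = u x + integral {0..x} u"
proof -
  have hexp: "(\<lambda>t. h t * exp t) integrable_on {0..x}"
    using halfline_absolutely_integrable[OF h, of 0 x exp] set_lebesgue_integral_eq_integral(1)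
    by (auto simp: continuous_on_exp)
  have cancel: "h t * exp t * exp (- t) = h t" for t by (simp add: mult.assoc flip: exp_add)
  \<comment> \<open>By parts with the weight \<open>exp (- t)\<close>: the boundary term is
    \<open>u x\<close>, and the sign of the weight's derivative turns the other term into plus the
    integral of \<open>u\<close>.\<close>
  have "integral {0..x} (\<lambda>t. h t * exp t * exp (- t)) =
      integral {0..x} (\<lambda>t. h t * exp t) * exp (- x)
      - integral {0..x} (\<lambda>t. integral {0..t} (\<lambda>t. h t * exp t) * (- exp (- t)))"
  proof (rule integral_by_parts_primitive[OF hexp])
    fix t assume "t \<in> {0..x}"
    then show "\<bar>h t * exp t\<bar> \<le> C * exp x"
      using h(2)[of t] by (auto simp: abs_mult intro!: mult_mono)
  next
    show "(\<lambda>t. h t * exp t * exp (- t)) integrable_on {0..x}"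
      using halfline_integrable(2)[OF h] by (simp add: cancel)
  qed (use x in \<open>auto intro!: derivative_eq_intros continuous_intros\<close>)
  moreover have "(\<lambda>t. integral {0..t} (\<lambda>t. h t * exp t) * exp (- t)) = u"
    by (simp add: fun_eq_iff u_def exp_mean_abs_linf[OF h] exp_minus divide_inverse)
  then have "integral {0..t} (\<lambda>t. h t * exp t) * exp (- t) = u t" for t by (rule fun_cong)
  ultimately show ?thesis by (simp add: cancel)
qed

lemma F0_window_mean_tendsto:
  assumes f: "f \<in> F0" and \<theta>: "0 < \<theta>"
  shows "(window_mean f \<theta> \<longlongrightarrow> 0) at_top"
proof -
  obtain h C where fh: "f = abs_linf h" and h: "h \<in> borel_measurable halfline" "\<And>x. \<bar>h x\<bar> \<le> C"
    using linf_bounded_representative[of f] by metis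
  define u where "u = exp_mean f"
  have u0: "(u \<longlongrightarrow> 0) at_top" using f by (simp add: F0_def u_def)
  have uc: "continuous_on {0..x} u" for x
    using exp_mean_continuous[OF h] by (simp add: u_def fh)
  have ui: "u integrable_on {x..y}" if "0 \<le> x" for x y
    using that by (intro integrable_continuous_real continuous_on_subset[OF uc[of y]]) auto
  \<comment> \<open>The integrated equation at \<open>x + \<theta>\<close> minus the one at
    \<open>x\<close>. All three terms vanish at infinity because \<open>u\<close> does.\<close>
  have win: "integral {x..x + \<theta>} h = u (x + \<theta>) - u x + integral {x..x + \<theta>} u" if "0 \<le> x" for x
    using that \<theta> integral_eq_exp_mean[OF h, of "x + \<theta>"] integral_eq_exp_mean[OF h, of x]
      Henstock_Kurzweil_Integration.integral_combine[of 0 x "x + \<theta>" h] halfline_integrable(2)[OF h]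
      Henstock_Kurzweil_Integration.integral_combine[of 0 x "x + \<theta>" u] ui
    by (simp add: u_def fh)
  have I0: "((\<lambda>x. integral {x..x + \<theta>} u) \<longlongrightarrow> 0) at_top"
  proof (rule tendstoI)
    fix e :: real assume e: "0 < e"
    \<comment> \<open>This threshold makes the integral over a window of length
      \<open>\<theta>\<close> at most \<open>e / 2\<close>.\<close>
    obtain N where N: "\<And>x. N \<le> x \<Longrightarrow> \<bar>u x\<bar> < e / (2 * \<theta>)"
      using tendstoD[OF u0, of "e / (2 * \<theta>)"] e \<theta> by (auto simp: eventually_at_top_linorder)
    have "dist (integral {x..x + \<theta>} u) 0 < e" if "max 0 N \<le> x" for x
    proof -
      have "\<bar>integral {x..x + \<theta>} u\<bar> \<le> e / (2 * \<theta>) * (x + \<theta> - x)"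
        using that \<theta> N ui by (intro abs_integral_le) (auto intro: less_imp_le)
      then show ?thesis using e \<theta> by simp
    qed
    then show "\<forall>\<^sub>F x in at_top. dist (integral {x..x + \<theta>} u) 0 < e"
      unfolding eventually_at_top_linorder by blast
  qed
  have "((\<lambda>x. u (x + \<theta>)) \<longlongrightarrow> 0) at_top"
    by (rule filterlim_compose[OF u0])
      (use filterlim_tendsto_add_at_top[OF tendsto_const[of \<theta>] filterlim_ident] in \<open>simp add: add.commute\<close>)
  then have "((\<lambda>x. (u (x + \<theta>) - u x + integral {x..x + \<theta>} u) / \<theta>) \<longlongrightarrow> (0 - 0 + 0) / \<theta>) at_top"
    using \<theta> by (intro tendsto_intros u0 I0) auto
  moreover have "\<forall>\<^sub>F x in at_top. (u (x + \<theta>) - u x + integral {x..x + \<theta>} u) / \<theta> = window_mean f \<theta> x"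
    using eventually_ge_at_top[of 0]
    by eventually_elim (simp add: win[symmetric] fh window_mean_abs_linf[OF h])
  ultimately show ?thesis by (simp add: tendsto_cong)
qed

text \<open>By parts, \<open>exp_mean\<close> is the primitive \<open>H\<close> minus the
  exponentially weighted mean of \<open>H\<close>. By l'Hospital that mean has the same limit
  \<open>L\<close> as \<open>H\<close>, so the difference tends to 0.\<close>

lemma F0I_primitive:
  assumes h: "h \<in> borel_measurable halfline" "\<And>x. \<bar>h x\<bar> \<le> C"
    and HL: "((\<lambda>x. integral {0..x} h) \<longlongrightarrow> L) at_top"
  shows "abs_linf h \<in> F0"
proof -
  define H where "H x = integral {0..x} h" for x
  have Hc: "continuous_on {0..x} H" for x
    unfolding H_def using halfline_integrable(2)[OF h] by (intro indefinite_integral_continuous_1) auto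
  have eq: "exp_mean (abs_linf h) x = H x - integral {0..x} (\<lambda>t. H t * exp t) / exp x" if "0 \<le> x" for x
  proof -
    have "integral {0..x} (\<lambda>t. h t * exp t) = H x * exp x - integral {0..x} (\<lambda>t. H t * exp t)"
      unfolding H_def
    proof (rule integral_by_parts_primitive)
      show "(\<lambda>t. h t * exp t) integrable_on {0..x}"
        using halfline_absolutely_integrable[OF h, of 0 x exp] set_lebesgue_integral_eq_integral(1)
        by (auto simp: continuous_on_exp)
    qed (use h that halfline_integrable(2)[OF h] in
        \<open>auto intro!: derivative_eq_intros continuous_intros\<close>)
    then show ?thesis by (simp add: exp_mean_abs_linf[OF h] diff_divide_distrib)
  qed
  have "((\<lambda>x. integral {0..x} (\<lambda>t. H t * exp t) / exp x) \<longlongrightarrow> L) at_top"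
  proof (rule lhospital_at_top_at_top[where g' = exp and f' = "\<lambda>x. H x * exp x"])
    have "((\<lambda>x. integral {0..x} (\<lambda>t. H t * exp t)) has_real_derivative H x * exp x) (at x)"
      if "0 < x" for x
      using integral_has_real_derivative[of 0 "x + 1" "\<lambda>t. H t * exp t" x]
        continuous_on_mult[OF Hc[of "x + 1"] continuous_on_exp[OF continuous_on_id]] that
      by (simp add: at_within_Icc_at)
    then show "\<forall>\<^sub>F x in at_top.
        ((\<lambda>x. integral {0..x} (\<lambda>t. H t * exp t)) has_real_derivative H x * exp x) (at x)"
      by (auto intro: eventually_mono[OF eventually_gt_at_top[of 0]])
  qed (use HL in \<open>auto simp: H_def exp_at_top\<close>)
  then have "((\<lambda>x. H x - integral {0..x} (\<lambda>t. H t * exp t) / exp x) \<longlongrightarrow> L - L) at_top"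
    using HL by (intro tendsto_diff) (simp_all add: H_def)
  moreover have "\<forall>\<^sub>F x in at_top. H x - integral {0..x} (\<lambda>t. H t * exp t) / exp x = exp_mean (abs_linf h) x"
    using eventually_ge_at_top[of 0] by eventually_elim (simp add: eq)
  ultimately show ?thesis by (simp add: F0_def tendsto_cong)
qed

section \<open>Slowly refining block averages\<close>

text \<open>A diagonal choice. Each small \<open>\<theta>\<close> is good only beyond a threshold of
  its own, so \<open>T\<close> is a step function that moves on to a smaller value only after the
  threshold of that value has been passed.\<close>

lemma slowly_vanishing_choice:
  fixes P :: "real \<Rightarrow> real \<Rightarrow> bool"
  assumes "\<forall>\<^sub>F \<theta> in at_right 0. \<forall>\<^sub>F x in at_top. P \<theta> x"
  obtains T :: "real \<Rightarrow> real" and x0 where "0 \<le> x0" "\<And>x. 0 < T x" "antimono T"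
    "(T \<longlongrightarrow> 0) at_top" "\<And>x. x0 \<le> x \<Longrightarrow> P (T x) x"
proof -
  obtain b where b: "0 < b" "\<And>\<theta>. 0 < \<theta> \<Longrightarrow> \<theta> < b \<Longrightarrow> \<forall>\<^sub>F x in at_top. P \<theta> x"
    using assms by (auto simp: eventually_at_right_field)
  \<comment> \<open>Adding 2 keeps \<open>\<theta> 0 = b / 2\<close> strictly below
    \<open>b\<close>.\<close>
  define \<theta> where "\<theta> m = b / real (m + 2)" for m :: nat
  have \<theta>: "0 < \<theta> m" "\<theta> m < b" for m
    using b(1) mult_strict_left_mono[of 1 "real (m + 2)" b] by (auto simp: \<theta>_def divide_less_eq)
  have \<theta>_anti: "\<theta> n \<le> \<theta> m" if "m \<le> n" for m n
    using b(1) that by (auto simp: \<theta>_def intro!: divide_left_mono)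
  have \<theta>0: "\<theta> \<longlonglongrightarrow> 0"
    unfolding \<theta>_def
    by (rule real_tendsto_divide_at_top[OF tendsto_const])
      (auto intro!: filterlim_tendsto_add_at_top filterlim_real_sequentially)
  have "\<exists>X. \<forall>x\<ge>X. P (\<theta> m) x" for m
    using b(2)[OF \<theta>] by (simp add: eventually_at_top_linorder)
  then obtain X where X: "\<And>m x. X m \<le> x \<Longrightarrow> P (\<theta> m) x" by metis
  \<comment> \<open>\<open>X m \<le> Y m\<close> makes \<open>\<theta> m\<close> good from
    \<open>Y m\<close> on, and \<open>m \<le> Y m\<close> places every \<open>x\<close> below some
    \<open>Y (Suc m)\<close>.\<close>
  define Y where "Y m = real m + (\<Sum>i\<le>m. \<bar>X i\<bar>)" for m
  have YX: "X m \<le> Y m" for m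
    using member_le_sum[of m "{..m}" "\<lambda>i. \<bar>X i\<bar>"] by (simp add: Y_def)
  have Ym: "real m \<le> Y m" for m by (simp add: Y_def sum_nonneg)
  \<comment> \<open>Arranged so that \<open>Y (idx x) \<le> x < Y (Suc (idx x))\<close>. At index 0
    the lower half requires \<open>Y 0 \<le> x\<close>, whence the starting point
    \<open>max 0 (Y 0)\<close>.\<close>
  define idx where "idx x = (LEAST m. x < Y (Suc m))" for x
  have idx_ex: "\<exists>m. x < Y (Suc m)" for x
  proof -
    obtain m where "x < real m" using reals_Archimedean2 by blast
    also have "real m \<le> Y (Suc m)" using Ym[of "Suc m"] by simp
    finally show ?thesis by blast
  qed
  have idx: "x < Y (Suc (idx x))" for x
    unfolding idx_def using idx_ex by (rule LeastI_ex)
  have idx_le: "Y (idx x) \<le> x" if "Y 0 \<le> x" for x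
  proof (cases "idx x")
    case (Suc m)
    then have "\<not> x < Y (Suc m)" using not_less_Least[of m "\<lambda>m. x < Y (Suc m)"] by (simp add: idx_def)
    then show ?thesis using Suc by simp
  qed (use that in simp)
  have idx_mono: "idx x \<le> idx y" if "x \<le> y" for x y
    using idx[of y] that unfolding idx_def[of x] by (intro Least_le) simp
  have idx_lim: "filterlim idx at_top at_top"
    unfolding filterlim_at_top
  proof
    fix n
    have "n \<le> idx x" if "Max (Y ` {..n}) \<le> x" for x
    proof (rule ccontr)
      assume "\<not> n \<le> idx x"
      then have "Y (Suc (idx x)) \<le> Max (Y ` {..n})" by (intro Max_ge) auto
      with idx[of x] that show False by simp
    qed
    then show "\<forall>\<^sub>F x in at_top. n \<le> idx x" unfolding eventually_at_top_linorder by blast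
  qed
  show thesis
  proof (rule that[of "max 0 (Y 0)" "\<lambda>x. \<theta> (idx x)"])
    show "((\<lambda>x. \<theta> (idx x)) \<longlongrightarrow> 0) at_top" by (rule filterlim_compose[OF \<theta>0 idx_lim])
    show "P (\<theta> (idx x)) x" if "max 0 (Y 0) \<le> x" for x
      using that by (intro X order_trans[OF YX idx_le]) simp
  qed (auto intro!: \<theta> antimonoI \<theta>_anti idx_mono)
qed

text \<open>Since \<open>a\<close> carries the mean of \<open>h\<close> over each block, the
  primitive of \<open>a - h\<close> returns to one value \<open>L\<close> at every block end. Inside
  a block it strays from \<open>L\<close> by at most a constant times the block length, which tends
  to 0.\<close>

lemma block_average_minus_mem_F0:
  assumes h: "h \<in> borel_measurable halfline" "\<And>x. \<bar>h x\<bar> \<le> C"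
    and T: "\<And>x. 0 < T x" "antimono T" "(T \<longlongrightarrow> 0) at_top" and x0: "0 \<le> x0"
    and c: "\<And>x. x0 \<le> x \<Longrightarrow> integral {x..x + T x} h \<le> c * T x"
  shows "\<exists>a C'. a \<in> borel_measurable halfline \<and> (\<forall>x. \<bar>a x\<bar> \<le> C') \<and> (\<forall>x. a x \<le> c) \<and>
    abs_linf (\<lambda>x. a x - h x) \<in> F0"
proof -
  define s where "s = rec_nat x0 (\<lambda>_ x. x + T x)"
  have s0: "s 0 = x0" and sS: "s (Suc j) = s j + T (s j)" for j by (simp_all add: s_def)
  have s_less: "s j < s (Suc j)" for j using T(1) by (simp add: sS)
  have s_mono: "s i \<le> s j" if "i \<le> j" for i j
    using lift_Suc_mono_le[of s, OF less_imp_le[OF s_less] that] .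
  have s_ge: "x0 \<le> s j" for j using s_mono[of 0 j] by (simp add: s0)
  \<comment> \<open>If the endpoints stayed below \<open>t\<close>, antitonicity would keep every
    block at least \<open>T t\<close> long, and these lengths sum to infinity.\<close>
  have s_unbounded: "\<exists>j. t < s (Suc j)" for t
  proof (rule ccontr)
    assume "\<nexists>j. t < s (Suc j)"
    then have le: "s j \<le> t" for j using s_less[of j] by (auto simp: not_less intro: less_le_trans less_imp_le)
    have lin: "x0 + real j * T t \<le> s j" for j
    proof (induction j)
      case (Suc j)
      moreover have "T t \<le> T (s j)" using T(2) le by (rule antimonoD)
      ultimately show ?case by (simp add: sS algebra_simps)
    qed (simp add: s0)
    obtain j where "(t - x0) / T t < real j" using reals_Archimedean2 by blast
    then have "t < x0 + real j * T t" using T(1)[of t] by (simp add: field_simps)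
    with lin[of j] le[of j] show False by simp
  qed
  \<comment> \<open>For \<open>t \<ge> x0\<close>, the index of the half-open block
    \<open>{s j..<s (Suc j)}\<close> containing \<open>t\<close>.\<close>
  define k where "k t = (LEAST j. t < s (Suc j))" for t
  have k_less: "t < s (Suc (k t))" for t
    unfolding k_def using s_unbounded by (rule LeastI_ex)
  have k_le: "s (k t) \<le> t" if "x0 \<le> t" for t
  proof (cases "k t")
    case (Suc m)
    then have "\<not> t < s (Suc m)" using not_less_Least[of m "\<lambda>j. t < s (Suc j)"] by (simp add: k_def)
    then show ?thesis using Suc by simp
  qed (use that in \<open>simp add: s0\<close>)
  have k_eq: "k t = j" if "s j \<le> t" "t < s (Suc j)" for j t
  proof -
    have "x0 \<le> t" using that(1) s_ge order_trans by blast
    have "\<not> Suc (k t) \<le> j" using s_mono[of "Suc (k t)" j] k_less[of t] that(1) by linarith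
    moreover have "\<not> Suc j \<le> k t" using s_mono[of "Suc j" "k t"] k_le[OF \<open>x0 \<le> t\<close>] that(2) by linarith
    ultimately show ?thesis by simp
  qed
  define A where "A j = integral {s j..s (Suc j)} h / T (s j)" for j
  \<comment> \<open>The value \<open>c\<close> before the first block keeps \<open>a \<le> c\<close>
    true everywhere.\<close>
  define a where "a t = (if t < x0 then c else A (k t))" for t
  define B where "B = max C \<bar>c\<bar>"
  have s_nonneg: "0 \<le> s j" for j using s_ge[of j] x0 by simp
  have hi: "h integrable_on {x..y}" if "0 \<le> x" for x y
    using halfline_integrable(2)[OF h that] .
  have A_le: "A j \<le> c" for j
    using c[OF s_ge[of j]] T(1)[of "s j"] by (simp add: A_def sS divide_le_eq)
  have A_abs: "\<bar>A j\<bar> \<le> C" for j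
    using abs_integral_le[of h "s j" "s (Suc j)" C] hi[OF s_nonneg] h(2) T(1)[of "s j"]
    by (simp add: A_def sS divide_le_eq)
  have a_abs: "\<bar>a t\<bar> \<le> B" for t using A_abs[of "k t"] by (auto simp: a_def B_def)
  have a_le: "a t \<le> c" for t using A_le by (simp add: a_def)
  have "k \<in> measurable borel (count_space UNIV)" unfolding k_def by measurable
  then have "a \<in> borel_measurable borel"
    unfolding a_def by measurable
  then have am: "a \<in> borel_measurable halfline"
    by (intro measurable_restrict_space1 measurable_completion) simp
  define g where "g t = a t - h t" for t
  have gm: "g \<in> borel_measurable halfline" unfolding g_def using am h(1) by measurable
  have g_abs: "\<bar>g t\<bar> \<le> B + C" for t using a_abs[of t] h(2)[of t] by (simp add: g_def)
  have gi: "g integrable_on {x..y}" if "0 \<le> x" for x y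
    using halfline_integrable(2)[OF gm g_abs that] .
  have block: "integral {s j..s (Suc j)} g = 0" for j
  proof -
    have "integral {s j..s (Suc j)} a = integral {s j..s (Suc j)} (\<lambda>_. A j)"
    \<comment> \<open>The right endpoint already belongs to the next block; a single point is
      negligible.\<close>
    proof (rule integral_spike[of "{s (Suc j)}"])
      fix t assume "t \<in> {s j..s (Suc j)} - {s (Suc j)}"
      then have t: "s j \<le> t" "t < s (Suc j)" by auto
      then show "A j = a t" using k_eq[OF t] s_ge[of j] by (simp add: a_def)
    qed simp
    also have "\<dots> = integral {s j..s (Suc j)} h"
      using T(1)[of "s j"] by (simp add: A_def sS)
    finally show ?thesis
      using halfline_integrable(2)[OF am a_abs s_nonneg] hi[OF s_nonneg]
      by (simp add: g_def[abs_def] Henstock_Kurzweil_Integration.integral_diff)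
  qed
  define L where "L = integral {0..x0} g"
  have U_s: "integral {0..s j} g = L" for j
  proof (induction j)
    case (Suc j)
    then show ?case
      using Henstock_Kurzweil_Integration.integral_combine[of 0 "s j" "s (Suc j)" g]
        block[of j] gi s_nonneg[of j] s_less[of j] by simp
  qed (simp add: s0 L_def)
  \<comment> \<open>No block is longer than \<open>T x0\<close>, so the block containing
    \<open>t\<close> starts at or after \<open>t - T x0\<close>, and its length is the value of
    \<open>T\<close> at its start.\<close>
  have U: "\<bar>integral {0..t} g - L\<bar> \<le> (B + C) * T (t - T x0)" if t: "x0 \<le> t" for t
  proof -
    have "integral {0..t} g - L = integral {s (k t)..t} g"
      using Henstock_Kurzweil_Integration.integral_combine[of 0 "s (k t)" t g]
        U_s[of "k t"] gi s_nonneg[of "k t"] k_le[OF t] by simp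
    also have "\<bar>\<dots>\<bar> \<le> (B + C) * (t - s (k t))"
      using k_le[OF t] g_abs gi[OF s_nonneg] by (intro abs_integral_le) auto
    also have "t - s (k t) \<le> T (t - T x0)"
    proof -
      have "t - s (k t) \<le> T (s (k t))" using k_less[of t] by (simp add: sS)
      moreover have "T (s (k t)) \<le> T x0" using T(2) s_ge by (rule antimonoD)
      moreover from calculation have "T (s (k t)) \<le> T (t - T x0)"
        by (intro antimonoD[OF T(2)]) simp
      ultimately show ?thesis by simp
    qed
    finally show ?thesis
      using g_abs[of 0] by (simp add: mult_left_mono)
  qed
  have "filterlim (\<lambda>t. t - T x0) at_top at_top"
    using filterlim_tendsto_add_at_top[OF tendsto_const[of "- T x0"] filterlim_ident] by simp
  then have "((\<lambda>t. (B + C) * T (t - T x0)) \<longlongrightarrow> 0) at_top"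
    by (intro tendsto_mult_right_zero filterlim_compose[OF T(3)])
  moreover have "\<forall>\<^sub>F t in at_top. norm (integral {0..t} g - L) \<le> (B + C) * T (t - T x0)"
    using eventually_ge_at_top[of x0] by eventually_elim (simp add: U)
  ultimately have "((\<lambda>t. integral {0..t} g - L) \<longlongrightarrow> 0) at_top"
    by (rule Lim_null_comparison[rotated])
  then have "((\<lambda>t. integral {0..t} g) \<longlongrightarrow> L) at_top" by (simp add: LIM_zero_iff)
  then have "abs_linf g \<in> F0" by (rule F0I_primitive[OF gm g_abs])
  then show ?thesis using am a_abs a_le unfolding g_def by blast
qed

section \<open>The functional \<open>Kbar\<close>\<close>

text \<open>A real-valued copy, to which Hahn-Banach applies; nothing is lost because
  \<open>Kbar\<close> is finite.\<close>

definition kbar :: "linf \<Rightarrow> real" where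
  "kbar f = real_of_ereal (Kbar f)"

lemma ereal_kbar: "ereal (kbar f) = Kbar f"
  using Kbar_finite[of f] by (simp add: kbar_def ereal_real)

text \<open>Together with \<open>kbar_le\<close> and \<open>kbar_ge\<close>, this replaces the limit
  of upper limits by inequalities between real window means.\<close>

lemma eventually_window_mean_less:
  assumes "kbar f < c"
  shows "\<forall>\<^sub>F \<theta> in at_right 0. \<forall>\<^sub>F x in at_top. window_mean f \<theta> x < c"
proof -
  have "Kbar f < ereal c" using assms by (simp flip: ereal_kbar)
  then have "\<forall>\<^sub>F \<theta> in at_right 0. Limsup at_top (\<lambda>x. ereal (window_mean f \<theta> x)) < ereal c"
    by (rule order_tendstoD(2)[OF Kbar_tendsto])
  then show ?thesis
    by eventually_elim (use Limsup_lessD in fastforce)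
qed

lemma kbar_le:
  assumes "\<forall>\<^sub>F \<theta> in at_right 0. \<forall>\<^sub>F x in at_top. window_mean f \<theta> x \<le> c"
  shows "kbar f \<le> c"
proof -
  have "\<forall>\<^sub>F \<theta> in at_right 0. Limsup at_top (\<lambda>x. ereal (window_mean f \<theta> x)) \<le> ereal c"
    using assms by eventually_elim (auto intro: Limsup_bounded)
  then have "Kbar f \<le> ereal c"
    by (intro tendsto_upperbound[OF Kbar_tendsto]) simp_all
  then show ?thesis by (simp flip: ereal_kbar)
qed

lemma kbar_ge:
  assumes "\<forall>\<^sub>F \<theta> in at_right 0. \<forall>\<^sub>F x in at_top. c \<le> window_mean f \<theta> x"
  shows "c \<le> kbar f"
proof (rule ccontr)
  assume "\<not> c \<le> kbar f"
  then have "\<forall>\<^sub>F \<theta> in at_right 0. \<forall>\<^sub>F x in at_top. window_mean f \<theta> x < c"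
    by (intro eventually_window_mean_less) simp
  with assms have "\<forall>\<^sub>F \<theta> in at_right (0::real). \<forall>\<^sub>F x in at_top :: real filter. False"
  proof eventually_elim
    case (elim \<theta>)
    then show ?case by eventually_elim simp
  qed
  then show False by simp
qed

section \<open>Sublinearity of \<open>kbar\<close> from the linearity of window means\<close>

lemma window_mean_add:
  assumes "0 \<le> x"
  shows "window_mean (f + g) \<theta> x = window_mean f \<theta> x + window_mean g \<theta> x"
proof -
  obtain h C where f: "f = abs_linf h" and h: "h \<in> borel_measurable halfline" "\<And>x. \<bar>h x\<bar> \<le> C"
    using linf_bounded_representative[of f] by metis
  obtain k D where g: "g = abs_linf k" and k: "k \<in> borel_measurable halfline" "\<And>x. \<bar>k x\<bar> \<le> D"
    using linf_bounded_representative[of g] by metis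
  have hk: "(\<lambda>x. h x + k x) \<in> borel_measurable halfline" "\<And>x. \<bar>h x + k x\<bar> \<le> C + D"
    using h(1) k(1) by measurable (use h(2) k(2) abs_triangle_ineq add_mono order_trans in blast)
  have "f + g = abs_linf (\<lambda>x. h x + k x)"
    unfolding f g using plus_linf.abs_eq[OF linf_relI_bounded[OF h] linf_relI_bounded[OF k]] .
  then show ?thesis
    using assms halfline_integrable(2)[OF h assms] halfline_integrable(2)[OF k assms]
    by (simp add: f g window_mean_abs_linf[OF h] window_mean_abs_linf[OF k]
        window_mean_abs_linf[OF hk] Henstock_Kurzweil_Integration.integral_add add_divide_distrib)
qed

lemma window_mean_scaleR:
  assumes "0 \<le> x"
  shows "window_mean (c *\<^sub>R f) \<theta> x = c * window_mean f \<theta> x"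
proof -
  obtain h C where f: "f = abs_linf h" and h: "h \<in> borel_measurable halfline" "\<And>x. \<bar>h x\<bar> \<le> C"
    using linf_bounded_representative[of f] by metis
  have ch: "(\<lambda>x. c * h x) \<in> borel_measurable halfline" "\<And>x. \<bar>c * h x\<bar> \<le> \<bar>c\<bar> * C"
    using h(1) by measurable (simp add: abs_mult mult_left_mono h(2))
  have "c *\<^sub>R f = abs_linf (\<lambda>x. c * h x)"
    unfolding f using scaleR_linf.abs_eq[OF linf_relI_bounded[OF h]] .
  then show ?thesis
    using assms by (simp add: f window_mean_abs_linf[OF h] window_mean_abs_linf[OF ch])
qed

lemma window_mean_nonneg: "linf_nonneg f \<Longrightarrow> 0 < \<theta> \<Longrightarrow> 0 \<le> window_mean f \<theta> x"
proof (transfer fixing: \<theta> x)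
  fix f :: "real \<Rightarrow> real" assume "AE x in halfline. 0 \<le> f x" and \<theta>: "0 < \<theta>"
  then have "AE t in halfline. 0 \<le> indicat_real {x..x + \<theta>} t *\<^sub>R f t"
    by (elim eventually_mono) (auto simp: indicator_def)
  then have "0 \<le> (LINT t:{x..x + \<theta>}|halfline. f t)"
    unfolding set_lebesgue_integral_def by (rule integral_nonneg_AE)
  then show "0 \<le> 1 / \<theta> * (LINT t:{x..x + \<theta>}|halfline. f t)" using \<theta> by simp
qed

lemma eventually_small_window_far_outI:
  fixes P :: "real \<Rightarrow> real \<Rightarrow> bool"
  shows "(\<And>\<theta> x. 0 < \<theta> \<Longrightarrow> 0 \<le> x \<Longrightarrow> P \<theta> x) \<Longrightarrow> \<forall>\<^sub>F \<theta> in at_right 0. \<forall>\<^sub>F x in at_top. P \<theta> x"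
  by (auto simp: eventually_at_filter intro!: always_eventually eventually_mono[OF eventually_ge_at_top[of 0]])

lemma sublinear_kbar: "sublinear kbar"
proof (rule sublinearI)
  fix f g
  show "kbar (f + g) \<le> kbar f + kbar g"
  proof (rule field_le_epsilon)
    fix e :: real assume "0 < e"
    then have "\<forall>\<^sub>F \<theta> in at_right 0. \<forall>\<^sub>F x in at_top. window_mean f \<theta> x < kbar f + e / 2"
      "\<forall>\<^sub>F \<theta> in at_right 0. \<forall>\<^sub>F x in at_top. window_mean g \<theta> x < kbar g + e / 2"
      by (auto intro!: eventually_window_mean_less)
    then have "\<forall>\<^sub>F \<theta> in at_right 0. \<forall>\<^sub>F x in at_top. window_mean (f + g) \<theta> x \<le> kbar f + kbar g + e"
    proof eventually_elim
      case (elim \<theta>)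
      then show ?case using eventually_ge_at_top[of 0]
        by eventually_elim (simp add: window_mean_add)
    qed
    then show "kbar (f + g) \<le> kbar f + kbar g + e" by (rule kbar_le)
  qed
next
  fix c :: real and f assume c: "0 < c"
  show "kbar (c *\<^sub>R f) \<le> c * kbar f"
  proof (rule field_le_epsilon)
    fix e :: real assume "0 < e"
    then have "\<forall>\<^sub>F \<theta> in at_right 0. \<forall>\<^sub>F x in at_top. window_mean f \<theta> x < kbar f + e / c"
      using c by (intro eventually_window_mean_less) simp
    then have "\<forall>\<^sub>F \<theta> in at_right 0. \<forall>\<^sub>F x in at_top. window_mean (c *\<^sub>R f) \<theta> x \<le> c * kbar f + e"
    proof eventually_elim
      case (elim \<theta>)
      then show ?case using eventually_ge_at_top[of 0]
        by eventually_elim (use c in \<open>simp add: window_mean_scaleR field_simps\<close>)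
    qed
    then show "kbar (c *\<^sub>R f) \<le> c * kbar f + e" by (rule kbar_le)
  qed
next
  have "window_mean 0 \<theta> x = 0" if "0 \<le> x" for \<theta> x
    using window_mean_scaleR[OF that, of 0 0] by simp
  then show "kbar 0 = 0"
    by (intro antisym kbar_le kbar_ge eventually_small_window_far_outI) auto
qed

lemma F0_eventually_abs_window_mean_le:
  assumes "f \<in> F0" "0 < e"
  shows "\<forall>\<^sub>F \<theta> in at_right 0. \<forall>\<^sub>F x in at_top. \<bar>window_mean f \<theta> x\<bar> \<le> e"
proof -
  have "\<forall>\<^sub>F x in at_top. \<bar>window_mean f \<theta> x\<bar> \<le> e" if "0 < \<theta>" for \<theta>
    using tendstoD[OF F0_window_mean_tendsto[OF assms(1) that] assms(2)]
    by eventually_elim simp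
  then show ?thesis by (auto simp: eventually_at_filter intro!: always_eventually)
qed

text \<open>With both signs, a linear functional below \<open>kbar\<close> is at most 0 at
  \<open>f\<close> and at \<open>- f\<close>, so it vanishes there.\<close>

lemma kbar_F0:
  assumes f: "f \<in> F0"
  shows "kbar f \<le> 0" "kbar (- f) \<le> 0"
proof -
  show "kbar f \<le> 0"
  proof (rule field_le_epsilon)
    fix e :: real assume "0 < e"
    from F0_eventually_abs_window_mean_le[OF f this] have "kbar f \<le> e"
      by (intro kbar_le) (auto simp: abs_le_iff elim!: eventually_mono)
    then show "kbar f \<le> 0 + e" by simp
  qed
  show "kbar (- f) \<le> 0"
  proof (rule field_le_epsilon)
    fix e :: real assume "0 < e"
    from F0_eventually_abs_window_mean_le[OF f this]
    have "\<forall>\<^sub>F \<theta> in at_right 0. \<forall>\<^sub>F x in at_top. window_mean (- f) \<theta> x \<le> e"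
    proof eventually_elim
      case (elim \<theta>)
      then show ?case using eventually_ge_at_top[of 0]
        by eventually_elim (use window_mean_scaleR[of _ "- 1" f] in \<open>simp add: abs_le_iff\<close>)
    qed
    then have "kbar (- f) \<le> e" by (rule kbar_le)
    then show "kbar (- f) \<le> 0 + e" by simp
  qed
qed

section \<open>The constant function 1 and the norm of positive functionals\<close>

lift_definition linf_one :: linf is "\<lambda>_. 1"
  by (simp add: linf_rel_def ess_bounded_const)

lemma norm_linf_one: "norm linf_one = 1"
  by transfer (use esssup_const[OF emeasure_halfline_nonzero, of "1::ereal"] in \<open>simp add: one_ereal_def\<close>)

lemma window_mean_linf_one:
  assumes "0 < \<theta>" "0 \<le> x"
  shows "window_mean linf_one \<theta> x = 1"
  using window_mean_abs_linf[of "\<lambda>_. 1" 1 x \<theta>] assms by (simp add: linf_one_def)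

text \<open>The two values force a linear functional below \<open>kbar\<close> to be 1 at
  \<open>linf_one\<close>.\<close>

lemma kbar_linf_one: "kbar linf_one = 1" "kbar (- linf_one) = - 1"
proof -
  show "kbar linf_one = 1"
    by (intro antisym kbar_le kbar_ge eventually_small_window_far_outI) (simp_all add: window_mean_linf_one)
  have "window_mean (- linf_one) \<theta> x = - 1" if "0 < \<theta>" "0 \<le> x" for \<theta> x
    using window_mean_scaleR[OF that(2), of "- 1" linf_one] that by (simp add: window_mean_linf_one)
  then show "kbar (- linf_one) = - 1"
    by (intro antisym kbar_le kbar_ge eventually_small_window_far_outI) simp_all
qed

text \<open>Yields positivity of a linear functional below \<open>kbar\<close>, through its value at
  \<open>- f\<close>.\<close>

lemma kbar_uminus_nonneg:
  assumes "linf_nonneg f"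
  shows "kbar (- f) \<le> 0"
  using window_mean_nonneg[OF assms] window_mean_scaleR[of _ "- 1" f]
  by (intro kbar_le eventually_small_window_far_outI) simp

lemma linf_nonneg_norm_minus: "linf_nonneg (norm f *\<^sub>R linf_one - f)"
proof transfer
  fix f assume "linf_rel f f"
  then have f: "ess_bounded f" by (simp add: linf_rel_def)
  obtain r where r: "ess_norm f = ereal r" using ess_norm_finite[OF f] by blast
  have "AE x in halfline. ereal \<bar>f x\<bar> \<le> ess_norm f"
    by (rule esssup_AE)
  then show "AE x in halfline. 0 \<le> real_of_ereal (ess_norm f) * 1 - f x"
    by eventually_elim (simp add: r)
qed

text \<open>Positivity at \<open>norm f *\<^sub>R linf_one - f\<close>, and the same for
  \<open>- f\<close>, bounds both signs.\<close>

lemma positive_linear_abs_le_norm: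
  assumes lin: "linear \<phi>" and pos: "\<And>f. linf_nonneg f \<Longrightarrow> 0 \<le> \<phi> f"
  shows "\<bar>\<phi> f\<bar> \<le> \<phi> linf_one * norm f"
proof -
  interpret linear \<phi> by (rule lin)
  have "\<phi> f \<le> \<phi> linf_one * norm f" for f
    using pos[OF linf_nonneg_norm_minus[of f]] by (simp add: diff scale mult.commute)
  from this[of f] this[of "- f"] show ?thesis by (simp add: neg abs_le_iff)
qed

text \<open>Norm 1 bounds the value from above. From below, positivity makes the value at
  \<open>linf_one\<close> an upper bound for the norm.\<close>

lemma \<D>_linf_one:
  assumes "\<phi> \<in> \<D>"
  shows "blinfun_apply \<phi> linf_one = 1"
proof (rule antisym)
  show "blinfun_apply \<phi> linf_one \<le> 1"
    using norm_blinfun[of \<phi> linf_one] assms by (simp add: \<D>_def norm_linf_one)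
  have "norm (blinfun_apply \<phi> f) \<le> blinfun_apply \<phi> linf_one * norm f" for f
    using positive_linear_abs_le_norm[of "blinfun_apply \<phi>" f] assms
    by (simp add: \<D>_def bounded_linear.linear[OF blinfun.bounded_linear_right])
  moreover have "0 \<le> blinfun_apply \<phi> linf_one"
  proof -
    have "linf_nonneg linf_one" by transfer simp
    then show ?thesis using assms by (simp add: \<D>_def)
  qed
  ultimately have "norm \<phi> \<le> blinfun_apply \<phi> linf_one"
    by (intro norm_blinfun_bound)
  then show "1 \<le> blinfun_apply \<phi> linf_one" using assms by (simp add: \<D>_def)
qed

text \<open>Positivity, the value 1 at \<open>linf_one\<close> and vanishing on \<open>F0\<close>
  are read off from \<open>kbar\<close> at suitable elements and their negatives. Boundedness is
  claimed too because it lets \<open>Blinfun \<phi>\<close> be evaluated as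
  \<open>\<phi>\<close>.\<close>

lemma \<D>I_le_kbar:
  assumes lin: "linear \<phi>" and le: "\<And>g. \<phi> g \<le> kbar g"
  shows "bounded_linear \<phi>" "Blinfun \<phi> \<in> \<D>"
proof -
  interpret linear \<phi> by (rule lin)
  have pos: "0 \<le> \<phi> f" if "linf_nonneg f" for f
    using kbar_uminus_nonneg[OF that] le[of "- f"] by (simp add: neg)
  have one: "\<phi> linf_one = 1"
    using le[of linf_one] le[of "- linf_one"] by (simp add: neg kbar_linf_one)
  have bd: "\<bar>\<phi> f\<bar> \<le> norm f" for f
    using positive_linear_abs_le_norm[OF lin pos, of f] one by simp
  show bl: "bounded_linear \<phi>"
    by (rule bounded_linear_intro[of _ 1]) (simp_all add: add scale bd)
  have F0: "\<phi> f = 0" if "f \<in> F0" for f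
    using kbar_F0[OF that] le[of f] le[of "- f"] by (simp add: neg)
  have "norm (Blinfun \<phi>) = 1"
  proof (rule antisym)
    show "norm (Blinfun \<phi>) \<le> 1"
      using bd by (intro norm_blinfun_bound) (simp_all add: bounded_linear_Blinfun_apply[OF bl])
    show "1 \<le> norm (Blinfun \<phi>)"
      using norm_blinfun[of "Blinfun \<phi>" linf_one]
      by (simp add: bounded_linear_Blinfun_apply[OF bl] one norm_linf_one)
  qed
  then show "Blinfun \<phi> \<in> \<D>"
    using pos F0 by (simp add: \<D>_def bounded_linear_Blinfun_apply[OF bl])
qed

section \<open>The upper bound for members of \<open>\<D>\<close> and the conclusion\<close>

lemma \<D>_le_kbar:
  assumes \<phi>: "\<phi> \<in> \<D>"
  shows "blinfun_apply \<phi> f \<le> kbar f"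
proof (rule field_le_epsilon)
  fix e :: real assume e: "0 < e"
  define c where "c = kbar f + e"
  obtain h C where f: "f = abs_linf h" and h: "h \<in> borel_measurable halfline" "\<And>x. \<bar>h x\<bar> \<le> C"
    using linf_bounded_representative[of f] by metis
  have "kbar f < c" using e by (simp add: c_def)
  \<comment> \<open>The window length shrinks with \<open>x\<close> while the mean stays below
    \<open>c\<close>; successive windows become the blocks.\<close>
  then obtain T x0 where x0: "0 \<le> x0" and T: "\<And>x. 0 < T x" "antimono T" "(T \<longlongrightarrow> 0) at_top"
    and win: "\<And>x. x0 \<le> x \<Longrightarrow> window_mean f (T x) x < c"
    using slowly_vanishing_choice[OF eventually_window_mean_less[of f c]] by metis
  have avg: "integral {x..x + T x} h \<le> c * T x" if "x0 \<le> x" for x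
    using win[OF that] T(1)[of x] x0 that
    by (simp add: f window_mean_abs_linf[OF h] divide_less_eq)
  obtain a C' where a: "a \<in> borel_measurable halfline" "\<And>x. \<bar>a x\<bar> \<le> C'" "\<And>x. a x \<le> c"
    and F0: "abs_linf (\<lambda>x. a x - h x) \<in> F0"
    using block_average_minus_mem_F0[OF h T x0 avg] by blast
  have "abs_linf a - f \<in> F0"
    using F0 minus_linf.abs_eq[OF linf_relI_bounded[OF a(1,2)] linf_relI_bounded[OF h]] by (simp add: f)
  then have "blinfun_apply \<phi> (abs_linf a - f) = 0" using \<phi> by (simp add: \<D>_def)
  then have "blinfun_apply \<phi> f = blinfun_apply \<phi> (abs_linf a)" by (simp add: blinfun.diff_right)
  \<comment> \<open>As \<open>a \<le> c\<close> everywhere, positivity at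
    \<open>c *\<^sub>R linf_one - abs_linf a\<close> and the value 1 at \<open>linf_one\<close> give
    the bound.\<close>
  also have "\<dots> \<le> c"
  proof -
    have c1: "c *\<^sub>R linf_one = abs_linf (\<lambda>_. c)"
      unfolding linf_one_def by (simp add: scaleR_linf.abs_eq[OF linf_relI_bounded[of "\<lambda>_. 1" 1]])
    have "c *\<^sub>R linf_one - abs_linf a = abs_linf (\<lambda>x. c - a x)"
      unfolding c1 by (rule minus_linf.abs_eq[OF linf_relI_bounded[of "\<lambda>_. c" "\<bar>c\<bar>"] linf_relI_bounded[OF a(1,2)]]) auto
    moreover have "linf_nonneg (abs_linf (\<lambda>x. c - a x))"
    proof (subst linf_nonneg.abs_eq)
      have "\<bar>c - a x\<bar> \<le> \<bar>c\<bar> + C'" for x using a(2)[of x] by linarith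
      then show "linf_rel (\<lambda>x. c - a x) (\<lambda>x. c - a x)"
        using a(1) by (intro linf_relI_bounded) auto
    qed (simp add: a(3))
    ultimately have "0 \<le> blinfun_apply \<phi> (c *\<^sub>R linf_one - abs_linf a)"
      using \<phi> by (simp add: \<D>_def)
    then show ?thesis by (simp add: blinfun.diff_right blinfun.scaleR_right \<D>_linf_one[OF \<phi>])
  qed
  finally show "blinfun_apply \<phi> f \<le> kbar f + e" by (simp add: c_def)
qed

theorem theorem3p4:
  fixes f :: linf
  shows "(SUP \<phi>\<in>\<D>. ereal (blinfun_apply \<phi> f)) = Kbar f"
proof (rule antisym)
  show "(SUP \<phi>\<in>\<D>. ereal (blinfun_apply \<phi> f)) \<le> Kbar f"
    by (rule SUP_least) (simp add: \<D>_le_kbar flip: ereal_kbar)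
  \<comment> \<open>The supremum is attained at this functional, which lies in \<open>\<D>\<close>
    by domination.\<close>
  obtain \<phi> where \<phi>: "linear \<phi>" "\<And>g. \<phi> g \<le> kbar g" "\<phi> f = kbar f"
    using hahn_banach_sublinear[OF sublinear_kbar] by blast
  then have "Kbar f = ereal (blinfun_apply (Blinfun \<phi>) f)"
    by (simp add: bounded_linear_Blinfun_apply[OF \<D>I_le_kbar(1)[OF \<phi>(1,2)]] flip: ereal_kbar)
  then show "Kbar f \<le> (SUP \<phi>\<in>\<D>. ereal (blinfun_apply \<phi> f))"
    using \<D>I_le_kbar(2)[OF \<phi>(1,2)] by (metis SUP_upper)
qed

end
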